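(* For every $\varepsilon>0$ there is a coprime action of a finite group $A$ on a finite group $G$ with $C=C_G(A)$ abelian and $$\frac{|N_A(G)|}{|C/C'|}<\varepsilon .$$
   Context: Groups are finite and characters are complex. $A$ acts coprimely on $G$ if it acts by automorphisms and $\gcd(|A|,|G|)=1$. $C_G(A)$ is the subgroup of $A$-fixed elements of $G$; $C'$ is the derived subgroup of $C$. $\operatorname{Irr}_A(G)$ is the set of $A$-invariant irreducible characters of $G$, and $N_A(G)=\{\chi\in\operatorname{Irr}_A(G):\chi(c)\neq 0\text{ for all }c\in C_G(A)\}$. *)

theory Defs
  imports
    Complex_Main
    "HOL-Algebra.Bij"
    "HOL-Algebra.Coset"
    "HOL-Algebra.Generated_Groups"
    "Jordan_Normal_Form.VS_Connect"
begin

definition matrix_rep :: "('g, 'b) monoid_scheme \<Rightarrow> nat \<Rightarrow> ('g \<Rightarrow> complex mat) \<Rightarrow> bool" where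
  "matrix_rep G n \<rho> \<longleftrightarrow>
     (\<forall>g\<in>carrier G. \<rho> g \<in> carrier_mat n n) \<and>
     \<rho> \<one>\<^bsub>G\<^esub> = 1\<^sub>m n \<and>
     (\<forall>g\<in>carrier G. \<forall>h\<in>carrier G. \<rho> (g \<otimes>\<^bsub>G\<^esub> h) = \<rho> g * \<rho> h)"

definition irreducible_rep :: "('g, 'b) monoid_scheme \<Rightarrow> nat \<Rightarrow> ('g \<Rightarrow> complex mat) \<Rightarrow> bool" where
  "irreducible_rep G n \<rho> \<longleftrightarrow>
     matrix_rep G n \<rho> \<and> n > 0 \<and>
     (\<forall>W. VectorSpace.subspace class_ring W (module_vec TYPE(complex) n) \<and>
          (\<forall>g\<in>carrier G. \<forall>w\<in>W. \<rho> g *\<^sub>v w \<in> W)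
        \<longrightarrow> W = {0\<^sub>v n} \<or> W = carrier_vec n)"

text \<open>Characters are extensional, i.e. \<open>undefined\<close> outside the carrier, so that distinct
  characters differ at some group element and sets of characters have the right cardinality.\<close>

definition rep_character :: "('g, 'b) monoid_scheme \<Rightarrow> nat \<Rightarrow> ('g \<Rightarrow> complex mat) \<Rightarrow> 'g \<Rightarrow> complex" where
  "rep_character G n \<rho> = (\<lambda>g\<in>carrier G. \<Sum>i<n. \<rho> g $$ (i, i))"

definition Irr :: "('g, 'b) monoid_scheme \<Rightarrow> ('g \<Rightarrow> complex) set" where
  "Irr G = {rep_character G n \<rho> | n \<rho>. irreducible_rep G n \<rho>}"

definition coprime_action ::
    "('a, 'c) monoid_scheme \<Rightarrow> ('g, 'b) monoid_scheme \<Rightarrow> ('a \<Rightarrow> 'g \<Rightarrow> 'g) \<Rightarrow> bool" where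
  "coprime_action A G \<phi> \<longleftrightarrow>
     group A \<and> finite (carrier A) \<and> group G \<and> finite (carrier G) \<and>
     \<phi> \<in> hom A (AutoGroup G) \<and> coprime (card (carrier A)) (card (carrier G))"

definition fixed_points ::
    "('a, 'c) monoid_scheme \<Rightarrow> ('g, 'b) monoid_scheme \<Rightarrow> ('a \<Rightarrow> 'g \<Rightarrow> 'g) \<Rightarrow> 'g set" where
  "fixed_points A G \<phi> = {g \<in> carrier G. \<forall>a\<in>carrier A. \<phi> a g = g}"

definition fixed_subgroup ::
    "('a, 'c) monoid_scheme \<Rightarrow> ('g, 'b) monoid_scheme \<Rightarrow> ('a \<Rightarrow> 'g \<Rightarrow> 'g) \<Rightarrow> ('g, 'b) monoid_scheme" where
  "fixed_subgroup A G \<phi> = G\<lparr>carrier := fixed_points A G \<phi>\<rparr>"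

definition invariant_Irr ::
    "('a, 'c) monoid_scheme \<Rightarrow> ('g, 'b) monoid_scheme \<Rightarrow> ('a \<Rightarrow> 'g \<Rightarrow> 'g) \<Rightarrow> ('g \<Rightarrow> complex) set" where
  "invariant_Irr A G \<phi> =
     {\<chi> \<in> Irr G. \<forall>a\<in>carrier A. \<forall>g\<in>carrier G. \<chi> (\<phi> a g) = \<chi> g}"

definition nonvanishing_Irr ::
    "('a, 'c) monoid_scheme \<Rightarrow> ('g, 'b) monoid_scheme \<Rightarrow> ('a \<Rightarrow> 'g \<Rightarrow> 'g) \<Rightarrow> ('g \<Rightarrow> complex) set" where
  "nonvanishing_Irr A G \<phi> =
     {\<chi> \<in> invariant_Irr A G \<phi>. \<forall>c\<in>fixed_points A G \<phi>. \<chi> c \<noteq> 0}"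

definition abelianization :: "('g, 'b) monoid_scheme \<Rightarrow> 'g set monoid" where
  "abelianization G = G Mod (derived G (carrier G))"

end

theory Submission
  imports
    Defs
    "HOL-Library.Z2"
    "HOL-Library.Function_Algebras"
    "HOL-Library.Product_Plus"
    "HOL-Library.Cardinality"
    "HOL-Algebra.Weak_Morphisms"
begin

text \<open>
  The example is \<open>G = V \<rtimes> Q\<close>, where \<open>Q\<close> is the additive group of \<open>F\<^sub>4 \<times> F\<^sub>4 \<times> F\<^sub>8\<close> and \<open>V\<close> is the group of
  \<open>n\<close>-tuples of functions from \<open>Q\<close> to \<open>F\<^sub>2\<close>, on which \<open>Q\<close> acts by translation: the wreath product of \<open>F\<^sub>2\<^sup>n\<close> by \<open>Q\<close>. The
  group \<open>A\<close>, cyclic of order 21, is generated by the automorphism \<open>T\<close> of \<open>Q\<close> that multiplies each coordinate by a generator of the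
  multiplicative group of its field. It acts on \<open>G\<close>, a 2-group, through the arguments of the functions. As \<open>T\<close> fixes only
  0 in \<open>Q\<close>, the group \<open>C\<close> consists of the \<open>T\<close>-invariant elements of \<open>V\<close> and is abelian.

  The linear characters of \<open>V\<close> are \<open>\<lambda>\<^sub>g v = (-1) ^ (\<Sum>i x. g i x * v i x)\<close> with \<open>g\<close> in \<open>V\<close>. By Clifford theory every
  irreducible character of \<open>G\<close> is induced from an extension of some \<open>\<lambda>\<^sub>g\<close> to its inertia group \<open>V \<rtimes> Q\<^sub>g\<close>
  (\<open>irreducible_character\<close>, a consequence of \<open>monomial_character\<close>); it is determined by \<open>g\<close> and one
  of at most \<open>128\<close> twists. If it is \<open>A\<close>-invariant, then \<open>g\<close> can be chosen \<open>T\<close>-invariant within its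
  \<open>Q\<close>-orbit, because \<open>T - id\<close> is bijective on \<open>Q\<close> (\<open>invariant_character\<close>).

  On \<open>V\<close> such a character is proportional to \<open>v \<mapsto> \<Sum>q. \<lambda>\<^sub>g (q v)\<close>. Suppose that some component \<open>g i\<close> has odd sum. In the group
  algebra of \<open>Q\<close> over \<open>F\<^sub>2\<close> the element \<open>g i\<close> is then its own inverse, so for every \<open>T\<close>-invariant function \<open>b\<close>
  there is an element of \<open>C\<close> on whose translates \<open>\<lambda>\<^sub>g\<close> takes the values \<open>(-1) ^ b q\<close>. There is such a
  \<open>b\<close> that takes the values 0 and 1 equally often (\<open>balanced7\<close>), and at the corresponding element of \<open>C\<close> the character vanishes
  (\<open>odd_copy_vanishes\<close>). Hence a character in \<open>N\<^sub>A(G)\<close> comes from a \<open>g\<close> all of whose components have even sum. These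
  are a fraction \<open>1 / 2 ^ n\<close> of the \<open>T\<close>-invariant elements of \<open>V\<close>, that is, of \<open>C\<close>, so the ratio in question is at most
  \<open>128 / 2 ^ n\<close>. Finally the group is copied to the natural numbers (\<open>transport_action\<close>).
\<close>

section \<open>Sums and traces of matrices\<close>

text \<open>The dimension is passed explicitly because matrices of arbitrary size form no additive monoid:
  an empty sum has to know its size.\<close>

definition mat_sum :: "nat \<Rightarrow> 'x set \<Rightarrow> ('x \<Rightarrow> complex mat) \<Rightarrow> complex mat" where
  "mat_sum d X F = mat d d (\<lambda>ij. \<Sum>x\<in>X. F x $$ ij)"

definition mat_trace :: "complex mat \<Rightarrow> complex" where
  "mat_trace A = (\<Sum>i<dim_row A. A $$ (i, i))"

lemma mat_sum_carrier [simp]: "mat_sum d X F \<in> carrier_mat d d"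
  by (simp add: mat_sum_def)

lemma mat_sum_index: "i < d \<Longrightarrow> j < d \<Longrightarrow> mat_sum d X F $$ (i, j) = (\<Sum>x\<in>X. F x $$ (i, j))"
  by (simp add: mat_sum_def)

lemma mat_sum_cong: "(\<And>x. x \<in> X \<Longrightarrow> F x = F' x) \<Longrightarrow> mat_sum d X F = mat_sum d X F'"
  by (simp add: mat_sum_def cong: sum.cong)

lemma mat_sum_reindex: "bij_betw f X Y \<Longrightarrow> mat_sum d Y F = mat_sum d X (\<lambda>x. F (f x))"
  unfolding mat_sum_def by (intro cong_mat refl) (simp add: sum.reindex_bij_betw[symmetric])

lemma mult_index:
  assumes "A \<in> carrier_mat d d" "B \<in> carrier_mat d d" "i < d" "j < d"
  shows "(A * B) $$ (i, j) = (\<Sum>k<d. A $$ (i, k) * B $$ (k, j))"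
  using assms by (simp add: scalar_prod_def atLeast0LessThan)

lemma mult_mat_sum:
  assumes "A \<in> carrier_mat d d" "\<And>x. x \<in> X \<Longrightarrow> F x \<in> carrier_mat d d"
  shows "A * mat_sum d X F = mat_sum d X (\<lambda>x. A * F x)"
proof (rule eq_matI)
  fix i j assume "i < dim_row (mat_sum d X (\<lambda>x. A * F x))" "j < dim_col (mat_sum d X (\<lambda>x. A * F x))"
  then have ij: "i < d" "j < d" by (simp_all add: mat_sum_def)
  have "(A * mat_sum d X F) $$ (i, j) = (\<Sum>k<d. \<Sum>x\<in>X. A $$ (i, k) * F x $$ (k, j))"
    using assms ij by (simp add: mult_index mat_sum_index sum_distrib_left)
  also have "\<dots> = (\<Sum>x\<in>X. (A * F x) $$ (i, j))"
    by (subst sum.swap) (simp add: mult_index[OF assms ij])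
  finally show "(A * mat_sum d X F) $$ (i, j) = mat_sum d X (\<lambda>x. A * F x) $$ (i, j)"
    using ij by (simp add: mat_sum_index)
qed (use assms in \<open>auto simp: mat_sum_def\<close>)

lemma mat_sum_mult:
  assumes "A \<in> carrier_mat d d" "\<And>x. x \<in> X \<Longrightarrow> F x \<in> carrier_mat d d"
  shows "mat_sum d X F * A = mat_sum d X (\<lambda>x. F x * A)"
proof (rule eq_matI)
  fix i j assume "i < dim_row (mat_sum d X (\<lambda>x. F x * A))" "j < dim_col (mat_sum d X (\<lambda>x. F x * A))"
  then have ij: "i < d" "j < d" by (simp_all add: mat_sum_def)
  have "(mat_sum d X F * A) $$ (i, j) = (\<Sum>k<d. \<Sum>x\<in>X. F x $$ (i, k) * A $$ (k, j))"
    using ij by (simp add: mult_index[OF mat_sum_carrier assms(1)] mat_sum_index sum_distrib_right)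
  also have "\<dots> = (\<Sum>x\<in>X. (F x * A) $$ (i, j))"
    by (subst sum.swap) (simp add: mult_index[OF assms(2) assms(1) ij])
  finally show "(mat_sum d X F * A) $$ (i, j) = mat_sum d X (\<lambda>x. F x * A) $$ (i, j)"
    using ij by (simp add: mat_sum_index)
qed (use assms in \<open>auto simp: mat_sum_def\<close>)

lemma mat_sum_smult_const:
  assumes "M \<in> carrier_mat d d"
  shows "mat_sum d X (\<lambda>x. c x \<cdot>\<^sub>m M) = (\<Sum>x\<in>X. c x) \<cdot>\<^sub>m M"
  using assms by (intro eq_matI) (auto simp: mat_sum_def sum_distrib_right)

lemma mat_trace_mat_sum:
  assumes "\<And>x. x \<in> X \<Longrightarrow> F x \<in> carrier_mat d d"
  shows "mat_trace (mat_sum d X F) = (\<Sum>x\<in>X. mat_trace (F x))"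
proof -
  have "mat_trace (mat_sum d X F) = (\<Sum>i<d. \<Sum>x\<in>X. F x $$ (i, i))"
    by (simp add: mat_trace_def mat_sum_def)
  also have "\<dots> = (\<Sum>x\<in>X. mat_trace (F x))"
    by (subst sum.swap) (use assms in \<open>auto simp: mat_trace_def intro!: sum.cong\<close>)
  finally show ?thesis .
qed

lemma mat_trace_mult_commute:
  assumes "A \<in> carrier_mat d d" "B \<in> carrier_mat d d"
  shows "mat_trace (A * B) = mat_trace (B * A)"
proof -
  have "mat_trace (A * B) = (\<Sum>i<d. \<Sum>k<d. A $$ (i, k) * B $$ (k, i))"
    using assms by (simp add: mat_trace_def scalar_prod_def atLeast0LessThan)
  also have "\<dots> = (\<Sum>k<d. \<Sum>i<d. B $$ (k, i) * A $$ (i, k))"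
    by (subst sum.swap) (simp add: mult.commute)
  also have "\<dots> = mat_trace (B * A)"
    using assms by (simp add: mat_trace_def scalar_prod_def atLeast0LessThan)
  finally show ?thesis .
qed

lemma mat_trace_smult: "mat_trace (c \<cdot>\<^sub>m A) = c * mat_trace A" if "A \<in> carrier_mat d d"
  using that by (simp add: mat_trace_def sum_distrib_left)

section \<open>Irreducible representations and induced linear characters\<close>

text \<open>A matrix representation extends linearly to the group algebra, whose elements are coefficient
  functions on the group; \<open>alg_image\<close> below is this extension.\<close>

locale finite_rep = group G for G :: "('g, 'b) monoid_scheme" (structure) +
  fixes d :: nat and \<rho> :: "'g \<Rightarrow> complex mat"
  assumes fin: "finite (carrier G)" and rep: "matrix_rep G d \<rho>"
begin

lemma rep_carrier [simp]: "x \<in> carrier G \<Longrightarrow> \<rho> x \<in> carrier_mat d d"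
  and rep_one: "\<rho> \<one> = 1\<^sub>m d"
  and rep_mult: "x \<in> carrier G \<Longrightarrow> y \<in> carrier G \<Longrightarrow> \<rho> (x \<otimes> y) = \<rho> x * \<rho> y"
  using rep by (auto simp: matrix_rep_def)

definition alg_image :: "('g \<Rightarrow> complex) \<Rightarrow> complex mat" where
  "alg_image c = mat_sum d (carrier G) (\<lambda>x. c x \<cdot>\<^sub>m \<rho> x)"

lemma alg_image_carrier [simp]: "alg_image c \<in> carrier_mat d d"
  by (simp add: alg_image_def)

lemma alg_image_index: "i < d \<Longrightarrow> j < d \<Longrightarrow> alg_image c $$ (i, j) = (\<Sum>x\<in>carrier G. c x * \<rho> x $$ (i, j))"
  unfolding alg_image_def mat_sum_index
  by (intro sum.cong refl) (metis carrier_matD index_smult_mat(1) rep_carrier)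

lemma alg_image_add: "alg_image (\<lambda>x. a x + b x) = alg_image a + alg_image b"
  by (intro eq_matI)
     (auto simp: alg_image_index distrib_right sum.distrib carrier_matD[OF alg_image_carrier])

lemma alg_image_smult: "alg_image (\<lambda>x. k * c x) = k \<cdot>\<^sub>m alg_image c"
  by (intro eq_matI)
     (auto simp: alg_image_index sum_distrib_left mult.assoc carrier_matD[OF alg_image_carrier])

lemma bij_translate_left: "y \<in> carrier G \<Longrightarrow> bij_betw (\<lambda>x. y \<otimes> x) (carrier G) (carrier G)"
  by (rule bij_betw_byWitness[where f' = "\<lambda>x. inv y \<otimes> x"]) (auto simp: m_assoc[symmetric])

lemma bij_translate_right: "y \<in> carrier G \<Longrightarrow> bij_betw (\<lambda>x. x \<otimes> y) (carrier G) (carrier G)"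
  by (rule bij_betw_byWitness[where f' = "\<lambda>x. x \<otimes> inv y"]) (auto simp: m_assoc)

lemma rep_mult_alg_image:
  assumes y: "y \<in> carrier G"
  shows "\<rho> y * alg_image c = alg_image (\<lambda>x. c (inv y \<otimes> x))"
proof -
  have "alg_image (\<lambda>x. c (inv y \<otimes> x)) = mat_sum d (carrier G) (\<lambda>x. c x \<cdot>\<^sub>m \<rho> (y \<otimes> x))"
    unfolding alg_image_def using y
    by (subst mat_sum_reindex[OF bij_translate_left[OF y]])
       (auto intro!: mat_sum_cong simp: m_assoc[symmetric])
  also have "\<dots> = mat_sum d (carrier G) (\<lambda>x. \<rho> y * (c x \<cdot>\<^sub>m \<rho> x))"
    using y by (intro mat_sum_cong) (simp add: rep_mult mult_smult_distrib[OF rep_carrier rep_carrier])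
  also have "\<dots> = \<rho> y * alg_image c"
    unfolding alg_image_def using y by (subst mult_mat_sum) auto
  finally show ?thesis ..
qed

lemma alg_mult_rep:
  assumes y: "y \<in> carrier G"
  shows "alg_image c * \<rho> y = alg_image (\<lambda>x. c (x \<otimes> inv y))"
proof -
  have "alg_image (\<lambda>x. c (x \<otimes> inv y)) = mat_sum d (carrier G) (\<lambda>x. c x \<cdot>\<^sub>m \<rho> (x \<otimes> y))"
    unfolding alg_image_def using y
    by (subst mat_sum_reindex[OF bij_translate_right[OF y]]) (auto intro!: mat_sum_cong simp: m_assoc)
  also have "\<dots> = mat_sum d (carrier G) (\<lambda>x. (c x \<cdot>\<^sub>m \<rho> x) * \<rho> y)"
    using y by (intro mat_sum_cong) (simp add: rep_mult mult_smult_assoc_mat[OF rep_carrier rep_carrier])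
  also have "\<dots> = alg_image c * \<rho> y"
    unfolding alg_image_def using y by (subst mat_sum_mult) auto
  finally show ?thesis ..
qed

lemma alg_image_mult:
  assumes "M \<in> carrier_mat d d"
  shows "alg_image c * M = mat_sum d (carrier G) (\<lambda>x. c x \<cdot>\<^sub>m (\<rho> x * M))"
  unfolding alg_image_def using assms
  by (subst mat_sum_mult) (auto intro!: mat_sum_cong mult_smult_assoc_mat[OF rep_carrier])

lemma mult_alg_image:
  assumes "M \<in> carrier_mat d d"
  shows "M * alg_image c = mat_sum d (carrier G) (\<lambda>x. c x \<cdot>\<^sub>m (M * \<rho> x))"
  unfolding alg_image_def using assms
  by (subst mult_mat_sum) (auto intro!: mat_sum_cong mult_smult_distrib[OF _ rep_carrier])

text \<open>The vectors \<open>alg_image c *\<^sub>v w\<close> form an invariant subspace that contains \<open>w\<close>, so they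
  exhaust the space.\<close>

lemma irreducible_cyclic:
  assumes irr: "irreducible_rep G d \<rho>"
    and w: "w \<in> carrier_vec d" "w \<noteq> 0\<^sub>v d" and u: "u \<in> carrier_vec d"
  obtains c where "u = alg_image c *\<^sub>v w"
proof -
  define W where "W = range (\<lambda>c. alg_image c *\<^sub>v w)"
  have "VectorSpace.subspace class_ring W (module_vec TYPE(complex) d)"
  proof -
    have 0: "0\<^sub>v d \<in> W"
    proof -
      have "alg_image (\<lambda>x. 0) = 0\<^sub>m d d"
        by (intro eq_matI) (auto simp: alg_image_index carrier_matD[OF alg_image_carrier])
      then have "alg_image (\<lambda>x. 0) *\<^sub>v w = 0\<^sub>v d" using w by (auto intro!: eq_vecI)
      then show ?thesis unfolding W_def by (metis rangeI)
    qed
    have plus: "v + v' \<in> W" if v: "v \<in> W" "v' \<in> W" for v v'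
    proof -
      obtain a b where "v = alg_image a *\<^sub>v w" "v' = alg_image b *\<^sub>v w" using v unfolding W_def by blast
      then have "v + v' = alg_image (\<lambda>x. a x + b x) *\<^sub>v w"
        by (simp add: alg_image_add add_mult_distrib_mat_vec[OF alg_image_carrier alg_image_carrier w(1)])
      then show ?thesis by (simp add: W_def)
    qed
    have smult: "k \<cdot>\<^sub>v v \<in> W" if v: "v \<in> W" for k v
    proof -
      obtain a where "v = alg_image a *\<^sub>v w" using v by (auto simp: W_def)
      then have "k \<cdot>\<^sub>v v = alg_image (\<lambda>x. k * a x) *\<^sub>v w"
        using w by (intro eq_vecI) (auto simp: alg_image_smult smult_scalar_prod_distrib carrier_matD[OF alg_image_carrier])
      then show ?thesis by (simp add: W_def)
    qed
    have car: "W \<subseteq> carrier_vec d"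
      unfolding W_def using w mult_mat_vec_carrier[OF alg_image_carrier] by blast
    show ?thesis
      unfolding VectorSpace.subspace_def
      by (intro conjI vec_vs submodule.intro vec_module)
         (use 0 plus smult car in \<open>auto simp: module_vec_simps\<close>)
  qed
  moreover have "\<rho> g *\<^sub>v v \<in> W" if g: "g \<in> carrier G" and v: "v \<in> W" for g v
  proof -
    obtain a where "v = alg_image a *\<^sub>v w" using v by (auto simp: W_def)
    then have "\<rho> g *\<^sub>v v = alg_image (\<lambda>x. a (inv g \<otimes> x)) *\<^sub>v w"
      using g w by (simp add: rep_mult_alg_image[symmetric] assoc_mult_mat_vec[OF rep_carrier alg_image_carrier])
    then show ?thesis by (simp add: W_def)
  qed
  moreover have "w \<in> W"
  proof -
    have "alg_image (\<lambda>x. if x = \<one> then 1 else 0) = 1\<^sub>m d"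
      using fin by (intro eq_matI)
        (auto simp: alg_image_index carrier_matD[OF alg_image_carrier] rep_one if_distrib[of "\<lambda>k. k * _"]
          sum.delta cong: if_cong)
    then have "alg_image (\<lambda>x. if x = \<one> then 1 else 0) *\<^sub>v w = w" using w by simp
    then show ?thesis unfolding W_def by (metis rangeI)
  qed
  ultimately have "W = carrier_vec d"
    using irr w unfolding irreducible_rep_def by blast
  then show ?thesis using u that by (auto simp: W_def)
qed


text \<open>The element \<open>E = (\<Sum>x. \<psi> (inv x) * \<rho> x)\<close> is \<open>card U\<close> times the projection to the \<open>\<psi>\<close>-eigenspace, and by
  Mackey's criterion \<open>E * \<rho> x * E\<close> is always a multiple of \<open>E\<close>. As every vector is
  \<open>alg_image c *\<^sub>v w\<close> with \<open>w\<close> a column of \<open>E\<close>, all columns of \<open>E\<close> are multiples of \<open>w\<close>, so \<open>E\<close> has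
  rank one and its trace is \<open>card U\<close>. The sum of the conjugates of \<open>E\<close> commutes with the
  representation and scales \<open>w\<close> by \<open>(card U)\<^sup>2\<close>, hence scales every vector by this number. Taking traces
  of its product with \<open>\<rho> g\<close> gives the formula for induced characters.

  Here \<open>\<psi>\<close> is a linear character of the subgroup \<open>U\<close>, extended by zero, and \<open>nonzero\<close> says that its
  eigenspace in the representation is not zero.\<close>

lemma monomial_character:
  fixes \<psi> :: "'g \<Rightarrow> complex"
  defines "U \<equiv> {x \<in> carrier G. \<psi> x \<noteq> 0}"
  assumes irr: "irreducible_rep G d \<rho>"
    and one: "\<psi> \<one> = 1"
    and mult: "\<And>x y. \<lbrakk>x \<in> carrier G; y \<in> carrier G; \<psi> x \<noteq> 0\<rbrakk> \<Longrightarrow>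
                 \<psi> (x \<otimes> y) = \<psi> x * \<psi> y \<and> \<psi> (y \<otimes> x) = \<psi> y * \<psi> x"
    and mackey: "\<And>x. \<lbrakk>x \<in> carrier G; \<psi> x = 0\<rbrakk> \<Longrightarrow>
                 \<exists>y\<in>U. inv x \<otimes> y \<otimes> x \<in> U \<and> \<psi> (inv x \<otimes> y \<otimes> x) \<noteq> \<psi> y"
    and nonzero: "alg_image (\<lambda>x. \<psi> (inv x)) \<noteq> 0\<^sub>m d d"
    and g: "g \<in> carrier G"
  shows "mat_trace (\<rho> g) = (\<Sum>x\<in>carrier G. \<psi> (x \<otimes> g \<otimes> inv x)) / of_nat (card U)"
proof -
  define E where "E = alg_image (\<lambda>x. \<psi> (inv x))"
  define N where "N = (of_nat (card U) :: complex)"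
  have E [simp]: "E \<in> carrier_mat d d" by (simp add: E_def)
  have zero_smult: "0 \<cdot>\<^sub>m A = 0\<^sub>m d d" if "A \<in> carrier_mat d d" for A :: "complex mat"
    using that by (intro eq_matI) auto
  have finU: "finite U" using fin by (simp add: U_def)
  have "\<one> \<in> U" using one by (simp add: U_def)
  then have N0: "N \<noteq> 0" using finU by (auto simp: N_def)
  have \<psi>_inv: "\<psi> (inv x) * \<psi> x = 1" if "x \<in> U" for x
    using mult[of x "inv x"] that one by (auto simp: U_def mult.commute)
  have \<psi>_inv0: "\<psi> (inv x) = 0" if "x \<in> carrier G" "x \<notin> U" for x
    using \<psi>_inv[of "inv x"] that by (auto simp: U_def)
  have sumU: "(\<Sum>x\<in>carrier G. \<psi> (inv x) * \<psi> x) = N"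
  proof -
    have "(\<Sum>x\<in>carrier G. \<psi> (inv x) * \<psi> x) = (\<Sum>x\<in>U. \<psi> (inv x) * \<psi> x)"
      using fin by (intro sum.mono_neutral_right) (auto simp: U_def)
    then show ?thesis by (simp add: \<psi>_inv N_def)
  qed
  have rE: "\<rho> y * E = \<psi> y \<cdot>\<^sub>m E" if y: "y \<in> U" for y
  proof -
    have yG: "y \<in> carrier G" using y by (simp add: U_def)
    have "\<rho> y * E = alg_image (\<lambda>x. \<psi> (inv (inv y \<otimes> x)))" by (simp add: E_def rep_mult_alg_image[OF yG])
    also have "\<dots> = alg_image (\<lambda>x. \<psi> y * \<psi> (inv x))"
      unfolding alg_image_def using y yG
      by (intro mat_sum_cong) (auto simp: inv_mult_group mult U_def mult.commute)
    finally show ?thesis by (simp add: alg_image_smult E_def)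
  qed
  have Er: "E * \<rho> y = \<psi> y \<cdot>\<^sub>m E" if y: "y \<in> U" for y
  proof -
    have yG: "y \<in> carrier G" using y by (simp add: U_def)
    have "E * \<rho> y = alg_image (\<lambda>x. \<psi> (inv (x \<otimes> inv y)))" by (simp add: E_def alg_mult_rep[OF yG])
    also have "\<dots> = alg_image (\<lambda>x. \<psi> y * \<psi> (inv x))"
      unfolding alg_image_def using y yG
      by (intro mat_sum_cong) (auto simp: inv_mult_group mult U_def mult.commute)
    finally show ?thesis by (simp add: alg_image_smult E_def)
  qed
  have EE: "E * E = N \<cdot>\<^sub>m E"
  proof -
    have "E * E = mat_sum d (carrier G) (\<lambda>x. \<psi> (inv x) \<cdot>\<^sub>m (\<rho> x * E))"
      by (subst (1) E_def) (rule alg_image_mult[OF E])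
    also have "\<dots> = mat_sum d (carrier G) (\<lambda>x. (\<psi> (inv x) * \<psi> x) \<cdot>\<^sub>m E)"
    proof (rule mat_sum_cong)
      fix x assume x: "x \<in> carrier G"
      show "\<psi> (inv x) \<cdot>\<^sub>m (\<rho> x * E) = (\<psi> (inv x) * \<psi> x) \<cdot>\<^sub>m E"
      proof (cases "x \<in> U")
        case True then show ?thesis by (intro eq_matI) (auto simp: rE)
      next
        case False
        then show ?thesis
          using x by (simp add: \<psi>_inv0 zero_smult[OF mult_carrier_mat[OF rep_carrier E]] zero_smult[OF E])
      qed
    qed
    finally show ?thesis by (simp add: mat_sum_smult_const[OF E] sumU)
  qed
  \<comment> \<open>Mackey: moving \<open>y\<close> across \<open>x\<close> multiplies \<open>E * \<rho> x * E\<close> by two different scalars unless \<open>x\<close> is in \<open>U\<close>.\<close>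
  have ErE: "E * \<rho> x * E = (N * \<psi> x) \<cdot>\<^sub>m E" if x: "x \<in> carrier G" for x
  proof (cases "x \<in> U")
    case True
    then show ?thesis by (simp add: Er EE mult_smult_assoc_mat[OF E E]) (auto intro!: eq_matI)
  next
    case False
    then obtain y where y: "y \<in> U" and z: "inv x \<otimes> y \<otimes> x \<in> U"
      and ne: "\<psi> (inv x \<otimes> y \<otimes> x) \<noteq> \<psi> y"
      using mackey[OF x] x by (auto simp: U_def)
    let ?z = "inv x \<otimes> y \<otimes> x"
    have yG: "y \<in> carrier G" using y by (simp add: U_def)
    have eq: "\<rho> y * \<rho> x = \<rho> x * \<rho> ?z"
      using x yG by (simp add: rep_mult[symmetric] m_assoc[symmetric])
    have "\<psi> y \<cdot>\<^sub>m (E * \<rho> x * E) = E * \<rho> y * \<rho> x * E"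
      using x by (simp add: Er[OF y] mult_smult_assoc_mat[OF E rep_carrier]
          mult_smult_assoc_mat[OF mult_carrier_mat[OF E rep_carrier] E])
    also have "\<dots> = E * (\<rho> y * \<rho> x) * E"
      using x yG by (simp add: assoc_mult_mat[OF E rep_carrier rep_carrier])
    also have "\<dots> = E * \<rho> x * (\<rho> ?z * E)"
      unfolding eq using x yG
      by (simp add: assoc_mult_mat[OF E rep_carrier rep_carrier, symmetric]
          assoc_mult_mat[OF mult_carrier_mat[OF E rep_carrier] rep_carrier E])
    also have "\<dots> = \<psi> ?z \<cdot>\<^sub>m (E * \<rho> x * E)"
      using x by (simp add: rE[OF z] mult_smult_distrib[OF mult_carrier_mat[OF E rep_carrier] E])
    finally have *: "\<psi> y \<cdot>\<^sub>m (E * \<rho> x * E) = \<psi> ?z \<cdot>\<^sub>m (E * \<rho> x * E)" .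
    have "E * \<rho> x * E = 0\<^sub>m d d"
    proof (rule eq_matI)
      fix i j assume ij: "i < dim_row (0\<^sub>m d d :: complex mat)" "j < dim_col (0\<^sub>m d d :: complex mat)"
      have car: "E * \<rho> x * E \<in> carrier_mat d d"
        using x by (intro mult_carrier_mat[OF mult_carrier_mat[OF E rep_carrier] E])
      have "\<psi> y * (E * \<rho> x * E) $$ (i, j) = \<psi> ?z * (E * \<rho> x * E) $$ (i, j)"
        using arg_cong[OF *, of "\<lambda>M. M $$ (i, j)"] ij carrier_matD[OF car] by simp
      then show "(E * \<rho> x * E) $$ (i, j) = 0\<^sub>m d d $$ (i, j)" using ne ij by simp
    qed (auto simp: carrier_matD[OF E])
    moreover have "\<psi> x = 0" using False x by (simp add: U_def)
    ultimately show ?thesis by (auto intro!: eq_matI simp: carrier_matD[OF E])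
  qed
  obtain i0 j0 where i0: "i0 < d" and j0: "j0 < d" and E00: "E $$ (i0, j0) \<noteq> 0"
    using nonzero unfolding E_def[symmetric]
    by (metis E carrier_matD(1) carrier_matD(2) eq_matI index_zero_mat(1) index_zero_mat(2) index_zero_mat(3))
  define w where "w = col E j0"
  have w [simp]: "w \<in> carrier_vec d" using j0 by (simp add: w_def carrier_vecI carrier_matD[OF E])
  have "w $ i0 \<noteq> 0" using i0 j0 E00 by (simp add: w_def carrier_matD[OF E])
  then have w0: "w \<noteq> 0\<^sub>v d" using i0 by auto
  have wcol: "A *\<^sub>v w = col (A * E) j0" if "A \<in> carrier_mat d d" for A
    using that j0 by (intro eq_vecI) (auto simp: w_def carrier_matD[OF E])
  note cyc = irreducible_cyclic[OF irr w w0]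

  \<comment> \<open>\<open>E\<close> has rank one: reach each unit vector from \<open>w\<close> and apply \<open>E\<close>.\<close>
  have "\<exists>\<kappa>. \<forall>i<d. E $$ (i, j) = \<kappa> * w $ i" if j: "j < d" for j
  proof -
    obtain c where c: "unit_vec d j = alg_image c *\<^sub>v w" using cyc[OF unit_vec_carrier] by blast
    have "col E j = E *\<^sub>v (alg_image c *\<^sub>v w)"
      unfolding c[symmetric] using j
      by (intro eq_vecI) (auto simp: carrier_matD[OF E] scalar_prod_right_unit)
    also have "\<dots> = E *\<^sub>v col (alg_image c * E) j0" by (simp add: wcol)
    also have "\<dots> = col (E * (alg_image c * E)) j0"
      using j0 by (intro eq_vecI) (auto simp: carrier_matD[OF E])
    also have "E * (alg_image c * E) = (E * alg_image c) * E"
      by (simp add: assoc_mult_mat[OF E alg_image_carrier E])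
    also have "E * alg_image c = mat_sum d (carrier G) (\<lambda>x. c x \<cdot>\<^sub>m (E * \<rho> x))" by (rule mult_alg_image[OF E])
    also have "\<dots> * E = mat_sum d (carrier G) (\<lambda>x. (c x \<cdot>\<^sub>m (E * \<rho> x)) * E)"
      by (intro mat_sum_mult[OF E] smult_carrier_mat mult_carrier_mat[OF E rep_carrier])
    also have "\<dots> = mat_sum d (carrier G) (\<lambda>x. (c x * (N * \<psi> x)) \<cdot>\<^sub>m E)"
      by (intro mat_sum_cong)
         (auto simp: mult_smult_assoc_mat[OF mult_carrier_mat[OF E rep_carrier] E] ErE intro!: eq_matI)
    also have "\<dots> = (\<Sum>x\<in>carrier G. c x * (N * \<psi> x)) \<cdot>\<^sub>m E" (is "_ = ?k \<cdot>\<^sub>m E")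
      by (rule mat_sum_smult_const[OF E])
    finally have *: "col E j = col (?k \<cdot>\<^sub>m E) j0" .
    have "E $$ (i, j) = ?k * w $ i" if "i < d" for i
      using arg_cong[OF *, of "\<lambda>v. v $ i"] that j j0 by (simp add: w_def carrier_matD[OF E])
    then show ?thesis by blast
  qed
  then obtain \<kappa> where \<kappa>: "\<And>i j. i < d \<Longrightarrow> j < d \<Longrightarrow> E $$ (i, j) = \<kappa> j * w $ i" by metis
  have traceE: "mat_trace E = N"
  proof -
    have "N * w $ i0 = (E * E) $$ (i0, j0)"
      using i0 j0 by (simp add: EE w_def carrier_matD[OF E])
    also have "\<dots> = (\<Sum>k<d. \<kappa> k * w $ i0 * w $ k)"
    proof -
      have "E $$ (k, j0) = w $ k" if "k < d" for k
        using that j0 by (simp add: w_def carrier_matD[OF E])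
      then show ?thesis
        unfolding mult_index[OF E E i0 j0] using i0 by (intro sum.cong) (auto simp: \<kappa>)
    qed
    also have "\<dots> = mat_trace E * w $ i0"
      by (simp add: mat_trace_def carrier_matD[OF E] \<kappa> sum_distrib_right) (simp add: ac_simps)
    finally show ?thesis using \<open>w $ i0 \<noteq> 0\<close> by simp
  qed
  have trace_rE: "mat_trace (\<rho> y * E) = N * \<psi> y" if y: "y \<in> carrier G" for y
  proof -
    have "N * mat_trace (\<rho> y * E) = mat_trace (\<rho> y * (E * E))"
      using y by (simp add: EE mult_smult_distrib[OF rep_carrier E] mat_trace_smult[OF mult_carrier_mat[OF rep_carrier E]])
    also have "\<rho> y * (E * E) = (\<rho> y * E) * E"
      using y by (intro assoc_mult_mat[symmetric, OF rep_carrier E E])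
    also have "mat_trace \<dots> = mat_trace (E * (\<rho> y * E))"
      using y by (intro mat_trace_mult_commute[OF mult_carrier_mat[OF rep_carrier E] E])
    also have "E * (\<rho> y * E) = E * \<rho> y * E"
      using y by (intro assoc_mult_mat[symmetric, OF E rep_carrier E])
    also have "mat_trace \<dots> = N * (N * \<psi> y)" by (simp add: ErE[OF y] mat_trace_smult[OF E] traceE)
    finally show ?thesis using N0 by simp
  qed

  \<comment> \<open>The sum of all conjugates of \<open>E\<close> is the scalar matrix \<open>N\<^sup>2\<close>.\<close>
  define J where "J = mat_sum d (carrier G) (\<lambda>x. \<rho> (inv x) * E * \<rho> x)"
  have J [simp]: "J \<in> carrier_mat d d" by (simp add: J_def)
  have Jcar: "x \<in> carrier G \<Longrightarrow> \<rho> (inv x) * E * \<rho> x \<in> carrier_mat d d" for x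
    by (intro mult_carrier_mat[OF mult_carrier_mat[OF rep_carrier E] rep_carrier]) auto
  have JE: "J * E = (N * N) \<cdot>\<^sub>m E"
  proof -
    have "J * E = mat_sum d (carrier G) (\<lambda>x. \<rho> (inv x) * E * \<rho> x * E)"
      unfolding J_def by (rule mat_sum_mult[OF E Jcar])
    also have "\<dots> = mat_sum d (carrier G) (\<lambda>x. (N * (\<psi> (inv x) * \<psi> x)) \<cdot>\<^sub>m E)"
    proof (rule mat_sum_cong)
      fix x assume x: "x \<in> carrier G"
      have "\<rho> (inv x) * E * \<rho> x * E = \<rho> (inv x) * (E * \<rho> x * E)"
        using x by (simp add: assoc_mult_mat[OF rep_carrier E rep_carrier]
            assoc_mult_mat[OF rep_carrier mult_carrier_mat[OF E rep_carrier] E])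
      also have "\<dots> = (N * \<psi> x) \<cdot>\<^sub>m (\<rho> (inv x) * E)"
        using x by (simp add: ErE mult_smult_distrib[OF rep_carrier E])
      also have "\<dots> = (N * (\<psi> (inv x) * \<psi> x)) \<cdot>\<^sub>m E"
      proof (cases "x \<in> U")
        case True
        have "\<psi> (inv x) \<noteq> 0" using \<psi>_inv[OF True] by auto
        then have "inv x \<in> U" using x by (simp add: U_def)
        then show ?thesis by (auto simp: rE intro!: eq_matI)
      next
        case False
        then show ?thesis
          using x by (simp add: U_def zero_smult[OF mult_carrier_mat[OF rep_carrier E]] zero_smult[OF E])
      qed
      finally show "\<rho> (inv x) * E * \<rho> x * E = (N * (\<psi> (inv x) * \<psi> x)) \<cdot>\<^sub>m E" .
    qed
    finally show ?thesis
      by (simp add: mat_sum_smult_const[OF E] sum_distrib_left[symmetric] sumU)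
  qed
  have Jr: "J * \<rho> y = \<rho> y * J" if y: "y \<in> carrier G" for y
  proof -
    have "\<rho> y * J = mat_sum d (carrier G) (\<lambda>x. \<rho> y * (\<rho> (inv x) * E * \<rho> x))"
      unfolding J_def using y by (intro mult_mat_sum) (auto intro: Jcar)
    also have "\<dots> = mat_sum d (carrier G) (\<lambda>x. \<rho> y * (\<rho> (inv (x \<otimes> y)) * E * \<rho> (x \<otimes> y)))"
      by (rule mat_sum_reindex[OF bij_translate_right[OF y]])
    also have "\<dots> = mat_sum d (carrier G) (\<lambda>x. \<rho> (inv x) * E * \<rho> x * \<rho> y)"
    proof (rule mat_sum_cong)
      fix x assume x: "x \<in> carrier G"
      have "\<rho> y * (\<rho> (inv (x \<otimes> y)) * E * \<rho> (x \<otimes> y)) = \<rho> y * \<rho> (inv (x \<otimes> y)) * E * \<rho> (x \<otimes> y)"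
        using x y by (simp add: assoc_mult_mat[OF rep_carrier rep_carrier mult_carrier_mat[OF E rep_carrier]]
          assoc_mult_mat[OF rep_carrier E rep_carrier]
          assoc_mult_mat[OF mult_carrier_mat[OF rep_carrier rep_carrier] E rep_carrier])
      also have "\<rho> y * \<rho> (inv (x \<otimes> y)) = \<rho> (inv x)"
        using x y by (simp add: rep_mult[symmetric] inv_mult_group m_assoc[symmetric])
      also have "\<rho> (inv x) * E * \<rho> (x \<otimes> y) = \<rho> (inv x) * E * \<rho> x * \<rho> y"
        using x y by (simp add: rep_mult assoc_mult_mat[OF mult_carrier_mat[OF rep_carrier E] rep_carrier rep_carrier])
      finally show "\<rho> y * (\<rho> (inv (x \<otimes> y)) * E * \<rho> (x \<otimes> y)) = \<rho> (inv x) * E * \<rho> x * \<rho> y" .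
    qed
    also have "\<dots> = J * \<rho> y"
      unfolding J_def using y by (subst mat_sum_mult) (auto intro: Jcar)
    finally show ?thesis ..
  qed
  have Jalg: "J * alg_image c = alg_image c * J" for c
    unfolding mult_alg_image[OF J] alg_image_mult[OF J] by (intro mat_sum_cong) (simp add: Jr)
  have "J *\<^sub>v u = (N * N) \<cdot>\<^sub>v u" if u: "u \<in> carrier_vec d" for u
  proof -
    obtain c where c: "u = alg_image c *\<^sub>v w" using cyc[OF u] by blast
    have "J *\<^sub>v u = alg_image c *\<^sub>v (J *\<^sub>v w)"
      unfolding c by (simp add: assoc_mult_mat_vec[OF J alg_image_carrier w, symmetric] Jalg
          assoc_mult_mat_vec[OF alg_image_carrier J w])
    also have "J *\<^sub>v w = (N * N) \<cdot>\<^sub>v w"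
      using j0 by (simp add: wcol JE) (auto simp: w_def carrier_matD[OF E] intro!: eq_vecI)
    finally show ?thesis unfolding c by (simp add: mult_mat_vec[OF alg_image_carrier w])
  qed note Ju = this
  have Jdiag: "J = (N * N) \<cdot>\<^sub>m 1\<^sub>m d"
  proof (rule eq_matI)
    fix i j assume "i < dim_row ((N * N) \<cdot>\<^sub>m 1\<^sub>m d)" "j < dim_col ((N * N) \<cdot>\<^sub>m 1\<^sub>m d)"
    then have ij: "i < d" "j < d" by auto
    have "J $$ (i, j) = (J *\<^sub>v unit_vec d j) $ i"
      using ij by (simp add: carrier_matD[OF J] scalar_prod_right_unit)
    then show "J $$ (i, j) = ((N * N) \<cdot>\<^sub>m 1\<^sub>m d) $$ (i, j)"
      using ij by (simp add: Ju)
  qed (auto simp: carrier_matD[OF J])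
  have "N * N * mat_trace (\<rho> g) = mat_trace (\<rho> g * J)"
    using g by (simp add: Jdiag mult_smult_distrib[OF rep_carrier one_carrier_mat] right_mult_one_mat[OF rep_carrier] mat_trace_smult[OF rep_carrier])
  also have "\<rho> g * J = mat_sum d (carrier G) (\<lambda>x. \<rho> g * (\<rho> (inv x) * E * \<rho> x))"
    unfolding J_def using g by (intro mult_mat_sum) (auto intro: Jcar)
  also have "mat_trace \<dots> = (\<Sum>x\<in>carrier G. mat_trace (\<rho> g * (\<rho> (inv x) * E * \<rho> x)))"
    using g by (intro mat_trace_mat_sum mult_carrier_mat[OF rep_carrier Jcar]) auto
  also have "\<dots> = (\<Sum>x\<in>carrier G. N * \<psi> (x \<otimes> g \<otimes> inv x))"
  proof (rule sum.cong)
    fix x assume x: "x \<in> carrier G"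
    have "\<rho> g * (\<rho> (inv x) * E * \<rho> x) = \<rho> g * \<rho> (inv x) * E * \<rho> x"
      using x g by (simp add: assoc_mult_mat[OF rep_carrier rep_carrier mult_carrier_mat[OF E rep_carrier]]
          assoc_mult_mat[OF rep_carrier E rep_carrier]
          assoc_mult_mat[OF mult_carrier_mat[OF rep_carrier rep_carrier] E rep_carrier])
    then have "mat_trace (\<rho> g * (\<rho> (inv x) * E * \<rho> x)) = mat_trace (\<rho> (g \<otimes> inv x) * E * \<rho> x)"
      using x g by (simp add: rep_mult)
    also have "\<dots> = mat_trace (\<rho> x * (\<rho> (g \<otimes> inv x) * E))"
      using x g by (intro mat_trace_mult_commute[OF mult_carrier_mat[OF rep_carrier E] rep_carrier]) auto
    also have "\<rho> x * (\<rho> (g \<otimes> inv x) * E) = \<rho> (x \<otimes> g \<otimes> inv x) * E"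
      using x g by (simp add: assoc_mult_mat[OF rep_carrier rep_carrier E, symmetric] rep_mult[symmetric] m_assoc)
    finally show "mat_trace (\<rho> g * (\<rho> (inv x) * E * \<rho> x)) = N * \<psi> (x \<otimes> g \<otimes> inv x)"
      using x g by (simp add: trace_rE)
  qed simp
  finally show ?thesis using N0 by (simp add: N_def[symmetric] sum_distrib_left[symmetric] field_simps)
qed

end

section \<open>Elementary abelian 2-groups\<close>

text \<open>These simplification rules would replace the ring operations of the field with two elements by bit
  operations, out of reach of the ring lemmas.\<close>

declare add_bit_eq_xor [simp del] mult_bit_eq_and [simp del]

lemma UNIV_bit: "(UNIV :: bit set) = {0, 1}"
  using bit_not_zero_iff by auto

instance bit :: finite
  by standard (simp add: UNIV_bit)

lemma bit_add_self [simp]: "(a :: bit) + a = 0"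
  by (cases "a = 0") auto

lemma bit_add_eq_0: "(a :: bit) + b = 0 \<longleftrightarrow> a = b"
  by (cases "a = 0"; cases "b = 0") auto

text \<open>The nontrivial complex character of the group with two elements.\<close>

definition bsign :: "bit \<Rightarrow> complex" where
  "bsign b = (if b = 0 then 1 else -1)"

lemma bsign_0 [simp]: "bsign 0 = 1" and bsign_1 [simp]: "bsign 1 = -1"
  by (simp_all add: bsign_def)

lemma bsign_add: "bsign (a + b) = bsign a * bsign b"
  by (cases "a = 0"; cases "b = 0") (auto simp: bsign_def)

lemma bsign_nonzero [simp]: "bsign b \<noteq> 0"
  by (simp add: bsign_def)

lemma bsign_eq_iff [simp]: "bsign a = bsign b \<longleftrightarrow> a = b"
  by (cases "a = 0"; cases "b = 0") (auto simp: bsign_def)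

lemma sum_eq_0_if_negated:
  fixes f :: "'x \<Rightarrow> complex"
  assumes "bij_betw h X X" "\<And>x. x \<in> X \<Longrightarrow> f (h x) = - f x"
  shows "(\<Sum>x\<in>X. f x) = 0"
proof -
  have "(\<Sum>x\<in>X. f x) = (\<Sum>x\<in>X. f (h x))" by (rule sum.reindex_bij_betw[OF assms(1), symmetric])
  also have "\<dots> = - (\<Sum>x\<in>X. f x)" by (simp add: assms(2) sum_negf)
  finally show ?thesis by simp
qed

text \<open>In characteristic 2 the off-diagonal terms cancel in pairs.\<close>

lemma sum_symmetric_bit:
  fixes F :: "'x \<Rightarrow> 'x \<Rightarrow> bit"
  assumes "finite X" "\<And>x y. F x y = F y x"
  shows "(\<Sum>x\<in>X. \<Sum>y\<in>X. F x y) = (\<Sum>x\<in>X. F x x)"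
  using assms(1)
proof (induction X)
  case (insert a X)
  have "(\<Sum>y\<in>X. F y a) = (\<Sum>y\<in>X. F a y)" by (simp add: assms(2)[of _ a])
  then have "(\<Sum>x\<in>insert a X. \<Sum>y\<in>insert a X. F x y)
      = F a a + ((\<Sum>y\<in>X. F a y) + (\<Sum>y\<in>X. F a y)) + (\<Sum>x\<in>X. \<Sum>y\<in>X. F x y)"
    using insert.hyps by (simp add: sum.distrib add.assoc del: bit_add_self)
  then show ?case using insert by simp
qed simp

section \<open>The wreath product and its irreducible characters\<close>

text \<open>Elements of the base group are \<open>n\<close>-tuples of bit-valued functions on \<open>'q\<close>, and \<open>'q\<close> acts on them by
  translations.\<close>

definition shift :: "'q::ab_group_add \<Rightarrow> (nat \<Rightarrow> 'q \<Rightarrow> bit) \<Rightarrow> nat \<Rightarrow> 'q \<Rightarrow> bit" where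
  "shift q v = (\<lambda>i x. v i (x + q))"

lemma shift_simps [simp]:
  "shift q (v + w) = shift q v + shift q w"
  "shift q (shift p v) = shift (q + p) v"
  "shift 0 v = v"
  "shift q 0 = 0"
  by (auto simp: shift_def fun_eq_iff ac_simps)

lemma bit_fun_add_self [simp]: "(v :: nat \<Rightarrow> 'q \<Rightarrow> bit) + v = 0"
  by (auto simp: fun_eq_iff)

lemma bit_fun_add_eq_0: "(v :: nat \<Rightarrow> 'q \<Rightarrow> bit) + w = 0 \<longleftrightarrow> v = w"
  by (simp add: fun_eq_iff bit_add_eq_0)

lemma shift_eq_iff: "shift q v = w \<longleftrightarrow> v = shift (- q) w"
  by auto

text \<open>A nondegenerate biadditive form with values in the field with two elements identifies \<open>'q\<close> with its
  own character group; in particular \<open>'q\<close> is elementary abelian of exponent at most 2. The group studied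
  here is the wreath product of an elementary abelian group of rank \<open>n\<close> by the regular action of \<open>'q\<close>.\<close>

locale wreath =
  fixes n :: nat and dot :: "'q::{finite,ab_group_add} \<Rightarrow> 'q \<Rightarrow> bit"
  assumes dot_add_left: "dot (a + b) x = dot a x + dot b x"
    and dot_add_right: "dot a (x + y) = dot a x + dot a y"
    and dot_nondegenerate: "x \<noteq> 0 \<Longrightarrow> \<exists>a. dot a x = 1"
begin

definition base :: "(nat \<Rightarrow> 'q \<Rightarrow> bit) set" where
  "base = {v. \<forall>i\<ge>n. \<forall>x. v i x = 0}"

definition pairing :: "(nat \<Rightarrow> 'q \<Rightarrow> bit) \<Rightarrow> (nat \<Rightarrow> 'q \<Rightarrow> bit) \<Rightarrow> bit" where
  "pairing g v = (\<Sum>i<n. \<Sum>x\<in>UNIV. g i x * v i x)"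

definition wreath_prod :: "((nat \<Rightarrow> 'q \<Rightarrow> bit) \<times> 'q) monoid" where
  "wreath_prod = \<lparr>carrier = base \<times> UNIV, mult = (\<lambda>(v, q) (w, p). (v + shift q w, q + p)), one = (0, 0)\<rparr>"

lemma base_add [simp]: "v \<in> base \<Longrightarrow> w \<in> base \<Longrightarrow> v + w \<in> base"
  and base_0 [simp]: "0 \<in> base"
  and base_shift [simp]: "shift q v \<in> base \<longleftrightarrow> v \<in> base"
proof -
  show "shift q v \<in> base \<longleftrightarrow> v \<in> base"
    unfolding base_def shift_def by simp (metis diff_add_cancel)
qed (auto simp: base_def)

lemma bij_betw_base_Pow: "bij_betw (\<lambda>v. {(i, x). v i x = 1}) base (Pow ({..<n} \<times> UNIV))"
proof (rule bij_betw_byWitness[where f' = "\<lambda>A i x. if (i, x) \<in> A then 1 else 0"])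
  show "(\<lambda>v. {(i, x). v i x = 1}) ` base \<subseteq> Pow ({..<n} \<times> UNIV)"
    by (auto simp: base_def not_le[symmetric])
qed (auto simp: base_def fun_eq_iff)

lemma finite_base [simp]: "finite base"
  using bij_betw_finite[OF bij_betw_base_Pow] by simp

lemma card_base: "card base = 2 ^ (n * CARD('q))"
  using bij_betw_same_card[OF bij_betw_base_Pow] by (simp add: card_Pow)

lemma pairing_add_left: "pairing (g + h) v = pairing g v + pairing h v"
  and pairing_add_right: "pairing g (v + w) = pairing g v + pairing g w"
  by (simp_all add: pairing_def distrib_right distrib_left sum.distrib)

lemma pairing_0 [simp]: "pairing 0 v = 0" "pairing g 0 = 0"
  by (simp_all add: pairing_def)

lemma pairing_commute: "pairing g v = pairing v g"
  by (simp add: pairing_def mult.commute)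

lemma pairing_shift: "pairing g (shift q v) = pairing (shift (- q) g) v"
proof -
  have "(\<Sum>x\<in>UNIV. g i x * v i (x + q)) = (\<Sum>x\<in>UNIV. g i (x - q) * v i x)" for i
    by (rule sum.reindex_bij_witness[of _ "\<lambda>x. x - q" "\<lambda>x. x + q"]) auto
  then show ?thesis by (simp add: pairing_def shift_def)
qed

lemma pairing_nondegenerate:
  assumes "v \<in> base" "v \<noteq> 0"
  shows "\<exists>g\<in>base. pairing g v = 1"
proof -
  obtain i x where ix: "v i x \<noteq> 0" using assms(2) by (auto simp: fun_eq_iff)
  then have i: "i < n" using assms(1) by (auto simp: base_def not_le[symmetric])
  define g where "g = (\<lambda>j y. if j = i \<and> y = x then 1 else 0 :: bit)"
  have "pairing g v = (\<Sum>j<n. if j = i then v i x else 0)"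
    unfolding pairing_def
  proof (rule sum.cong[OF refl])
    fix j
    have "(\<Sum>y\<in>UNIV. g j y * v j y) = (\<Sum>y\<in>UNIV. if y = x then (if j = i then v i x else 0) else 0)"
      by (intro sum.cong) (auto simp: g_def)
    then show "(\<Sum>y\<in>UNIV. g j y * v j y) = (if j = i then v i x else 0)" by simp
  qed
  also have "\<dots> = 1" using i ix by simp
  finally show ?thesis using i by (intro bexI[of _ g]) (auto simp: g_def base_def)
qed

text \<open>Orthogonality for the characters \<open>\<lambda>v. bsign (pairing g v)\<close> of the base group: translating by a vector
  that pairs to 1 with \<open>g\<close> changes the sign of each term.\<close>

lemma sum_bsign_pairing:
  assumes "g \<in> base"
  shows "(\<Sum>v\<in>base. bsign (pairing g v)) = (if g = 0 then of_nat (card base) else 0)"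
proof (cases "g = 0")
  case False
  then obtain u where u: "u \<in> base" "pairing g u = 1"
    using pairing_nondegenerate[OF assms] by (metis pairing_commute)
  have "bij_betw (\<lambda>v. v + u) base base"
    by (rule bij_betw_byWitness[where f' = "\<lambda>v. v + u"]) (auto simp: u add.assoc)
  then have "(\<Sum>v\<in>base. bsign (pairing g v)) = 0"
    by (rule sum_eq_0_if_negated) (simp add: pairing_add_right bsign_add u)
  then show ?thesis using False by simp
qed simp

lemma dot_0 [simp]: "dot 0 x = 0" "dot a 0 = 0"
  using dot_add_left[of 0 0 x] dot_add_right[of a 0 0] by simp_all

lemma dot_minus [simp]: "dot a (- x) = dot a x"
  by (metis bit_add_eq_0 dot_add_right dot_0(2) left_minus)

lemma sum_bsign_dot: "(\<Sum>a\<in>UNIV. bsign (dot a x)) = (if x = 0 then of_nat CARD('q) else 0)"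
proof (cases "x = 0")
  case False
  then obtain b where b: "dot b x = 1" using dot_nondegenerate by blast
  have "bij (\<lambda>a. a + b)" by (rule bij_betw_byWitness[where f' = "\<lambda>a. a - b"]) auto
  then have "(\<Sum>a\<in>UNIV. bsign (dot a x)) = 0"
    by (rule sum_eq_0_if_negated) (simp add: dot_add_left bsign_add b)
  then show ?thesis using False by simp
qed simp

lemma wreath_prod_simps [simp]:
  "carrier wreath_prod = base \<times> UNIV"
  "(v, q) \<otimes>\<^bsub>wreath_prod\<^esub> (w, p) = (v + shift q w, q + p)"
  "\<one>\<^bsub>wreath_prod\<^esub> = (0, 0)"
  by (simp_all add: wreath_prod_def)

lemma group_wreath_prod: "group wreath_prod"
proof (rule groupI)
  fix x assume "x \<in> carrier wreath_prod"
  then obtain v q where x: "x = (v, q)" "v \<in> base" by auto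
  show "\<exists>y\<in>carrier wreath_prod. y \<otimes>\<^bsub>wreath_prod\<^esub> x = \<one>\<^bsub>wreath_prod\<^esub>"
    by (intro bexI[of _ "(shift (- q) v, - q)"]) (auto simp: x)
qed (auto simp: add.assoc)

sublocale wreath_prod: group wreath_prod by (rule group_wreath_prod)

lemma inv_wreath_prod: "v \<in> base \<Longrightarrow> inv\<^bsub>wreath_prod\<^esub> (v, q) = (shift (- q) v, - q)"
  by (rule wreath_prod.inv_equality) auto

lemma finite_wreath_prod: "finite (carrier wreath_prod)"
  by simp

definition stab :: "(nat \<Rightarrow> 'q \<Rightarrow> bit) \<Rightarrow> 'q set" where
  "stab g = {q. shift q g = g}"

lemma stab_0 [simp]: "0 \<in> stab g" by (simp add: stab_def)

lemma stab_add_left: "q \<in> stab g \<Longrightarrow> q + p \<in> stab g \<longleftrightarrow> p \<in> stab g"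
  unfolding stab_def mem_Collect_eq
  by (metis add.commute add.inverse_inverse minus_add_cancel shift_simps(2))

lemma stab_uminus: "- q \<in> stab g \<longleftrightarrow> q \<in> stab g"
  unfolding stab_def mem_Collect_eq by (metis shift_eq_iff add.inverse_inverse)

lemma pairing_shift_stab: "q \<in> stab g \<Longrightarrow> pairing g (shift q v) = pairing g v"
  using stab_uminus[of q g] by (simp add: pairing_shift stab_def)

text \<open>The inertia subgroup of the base character given by \<open>g\<close> is \<open>base \<times> stab g\<close>. Since it splits over the base
  group, that character extends to it, and its extensions are twists by characters of \<open>stab g\<close>;
  these are the restrictions of the characters \<open>\<lambda>q. bsign (dot a q)\<close>.\<close>

definition inertia_char :: "(nat \<Rightarrow> 'q \<Rightarrow> bit) \<Rightarrow> 'q \<Rightarrow> (nat \<Rightarrow> 'q \<Rightarrow> bit) \<times> 'q \<Rightarrow> complex" where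
  "inertia_char g a = (\<lambda>(v, q). if q \<in> stab g then bsign (pairing g v + dot a q) else 0)"

definition orbit_sum :: "(nat \<Rightarrow> 'q \<Rightarrow> bit) \<Rightarrow> (nat \<Rightarrow> 'q \<Rightarrow> bit) \<Rightarrow> complex" where
  "orbit_sum g v = (\<Sum>p\<in>UNIV. bsign (pairing g (shift p v)))"

text \<open>The value at \<open>(v, q)\<close> of the character induced from \<open>inertia_char g a\<close>: the base group is abelian and
  \<open>'q\<close> is abelian too, so conjugation only translates \<open>v\<close>, up to elements on which the inertia character is trivial.\<close>

definition induced_char :: "(nat \<Rightarrow> 'q \<Rightarrow> bit) \<Rightarrow> 'q \<Rightarrow> (nat \<Rightarrow> 'q \<Rightarrow> bit) \<times> 'q \<Rightarrow> complex" where
  "induced_char g a = (\<lambda>(v, q). if q \<in> stab g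
                         then bsign (dot a q) * orbit_sum g v / of_nat (card (stab g)) else 0)"

lemma inertia_char_mult:
  assumes "x \<in> carrier wreath_prod" "y \<in> carrier wreath_prod" "inertia_char g a x \<noteq> 0"
  shows "inertia_char g a (x \<otimes>\<^bsub>wreath_prod\<^esub> y) = inertia_char g a x * inertia_char g a y \<and> inertia_char g a (y \<otimes>\<^bsub>wreath_prod\<^esub> x) = inertia_char g a y * inertia_char g a x"
proof -
  obtain v q w p where xy: "x = (v, q)" "y = (w, p)" by (metis surj_pair)
  then have q: "q \<in> stab g" using assms(3) by (auto simp: inertia_char_def split: if_splits)
  show ?thesis
    using q stab_add_left[OF q, of p]
    by (auto simp: xy inertia_char_def pairing_add_right dot_add_right pairing_shift_stab bsign_add add.commute[of p q])
qed

text \<open>An element outside the inertia subgroup moves the base character given by \<open>g\<close> to a different one;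
  a base element that separates the two witnesses Mackey's criterion.\<close>

lemma inertia_char_mackey:
  assumes g: "g \<in> base" and x: "x \<in> carrier wreath_prod" and "inertia_char g a x = 0"
  shows "\<exists>y\<in>{y \<in> carrier wreath_prod. inertia_char g a y \<noteq> 0}. inv\<^bsub>wreath_prod\<^esub> x \<otimes>\<^bsub>wreath_prod\<^esub> y \<otimes>\<^bsub>wreath_prod\<^esub> x \<in> {y \<in> carrier wreath_prod. inertia_char g a y \<noteq> 0}
            \<and> inertia_char g a (inv\<^bsub>wreath_prod\<^esub> x \<otimes>\<^bsub>wreath_prod\<^esub> y \<otimes>\<^bsub>wreath_prod\<^esub> x) \<noteq> inertia_char g a y"
proof -
  obtain v q where vq: "x = (v, q)" "v \<in> base" using x by auto
  have q: "shift q g + g \<noteq> 0"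
    using assms(3) by (auto simp: vq inertia_char_def stab_def bit_fun_add_eq_0 split: if_splits)
  obtain u where u: "u \<in> base" "pairing (shift q g + g) u = 1"
    using pairing_nondegenerate[OF _ q] g by (metis base_add base_shift pairing_commute)
  have conj: "inv\<^bsub>wreath_prod\<^esub> x \<otimes>\<^bsub>wreath_prod\<^esub> (u, 0) \<otimes>\<^bsub>wreath_prod\<^esub> x = (shift (- q) u, 0)"
    using vq u(1) by (simp add: inv_wreath_prod add.commute[of "shift (- q) v"] add.assoc)
  have "pairing g (shift (- q) u) \<noteq> pairing g u"
    using u(2) by (auto simp: pairing_add_left pairing_shift)
  then show ?thesis
    using u(1) by (intro bexI[of _ "(u, 0)"]) (auto simp: conj inertia_char_def simp del: wreath_prod_simps(2))
qed

text \<open>Summed over all \<open>g\<close> and \<open>a\<close>, the inertia characters give a multiple of the indicator of the identity.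
  Therefore some of them must occur in any given representation.\<close>

lemma sum_inertia_char:
  assumes "x \<in> carrier wreath_prod"
  shows "(\<Sum>g\<in>base. \<Sum>a\<in>UNIV. inertia_char g a (inv\<^bsub>wreath_prod\<^esub> x)) = (if x = \<one>\<^bsub>wreath_prod\<^esub> then of_nat (card base * CARD('q)) else 0)"
proof -
  obtain v q where x: "x = (v, q)" "v \<in> base" using assms by auto
  show ?thesis
  proof (cases "q = 0")
    case True
    have "(\<Sum>g\<in>base. bsign (pairing g v)) = (if v = 0 then of_nat (card base) else 0)"
      using sum_bsign_pairing[OF x(2)] by (simp add: pairing_commute)
    then show ?thesis
      using True by (simp add: x inv_wreath_prod inertia_char_def sum_distrib_left[symmetric] split del: if_split)
        (auto simp: zero_prod_def[symmetric])
  next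
    case False
    have "(\<Sum>a\<in>UNIV. inertia_char g a (inv\<^bsub>wreath_prod\<^esub> x)) = 0" for g
      using False
      by (cases "- q \<in> stab g")
         (simp_all add: x inv_wreath_prod inertia_char_def bsign_add sum_distrib_left[symmetric] sum_bsign_dot)
    then show ?thesis using False by (simp add: x)
  qed
qed

lemma irreducible_character:
  assumes irr: "irreducible_rep wreath_prod d \<rho>"
  obtains g a where "g \<in> base" "\<And>x. x \<in> carrier wreath_prod \<Longrightarrow> mat_trace (\<rho> x) = induced_char g a x"
proof -
  interpret finite_rep wreath_prod d \<rho>
    using irr by unfold_locales (auto simp: irreducible_rep_def)
  have "\<exists>g\<in>base. \<exists>a. alg_image (\<lambda>x. inertia_char g a (inv\<^bsub>wreath_prod\<^esub> x)) \<noteq> 0\<^sub>m d d"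
  proof (rule ccontr)
    assume "\<not> ?thesis"
    then have 0: "alg_image (\<lambda>x. inertia_char g a (inv\<^bsub>wreath_prod\<^esub> x)) = 0\<^sub>m d d" if "g \<in> base" for g a using that by blast
    have d: "0 < d" using irr by (simp add: irreducible_rep_def)
    have "0 = (\<Sum>g\<in>base. \<Sum>a\<in>UNIV. alg_image (\<lambda>x. inertia_char g a (inv\<^bsub>wreath_prod\<^esub> x)) $$ (0, 0))"
      using d by (simp add: 0)
    also have "\<dots> = (\<Sum>g\<in>base. \<Sum>a\<in>UNIV. \<Sum>x\<in>carrier wreath_prod. inertia_char g a (inv\<^bsub>wreath_prod\<^esub> x) * \<rho> x $$ (0, 0))"
      using d by (simp add: alg_image_index del: wreath_prod_simps)
    also have "\<dots> = (\<Sum>g\<in>base. \<Sum>x\<in>carrier wreath_prod. \<Sum>a\<in>UNIV. inertia_char g a (inv\<^bsub>wreath_prod\<^esub> x) * \<rho> x $$ (0, 0))"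
      by (intro sum.cong refl sum.swap)
    also have "\<dots> = (\<Sum>x\<in>carrier wreath_prod. \<Sum>g\<in>base. \<Sum>a\<in>UNIV. inertia_char g a (inv\<^bsub>wreath_prod\<^esub> x) * \<rho> x $$ (0, 0))"
      by (rule sum.swap)
    also have "\<dots> = (\<Sum>x\<in>carrier wreath_prod. (\<Sum>g\<in>base. \<Sum>a\<in>UNIV. inertia_char g a (inv\<^bsub>wreath_prod\<^esub> x)) * \<rho> x $$ (0, 0))"
      by (simp add: sum_distrib_right del: wreath_prod_simps)
    also have "\<dots> = (\<Sum>x\<in>carrier wreath_prod. if x = \<one>\<^bsub>wreath_prod\<^esub> then of_nat (card base * CARD('q)) * \<rho> \<one>\<^bsub>wreath_prod\<^esub> $$ (0, 0) else 0)"
      by (intro sum.cong refl) (auto simp: sum_inertia_char simp del: wreath_prod_simps)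
    also have "\<dots> = of_nat (card base * CARD('q))"
      using d fin wreath_prod.one_closed by (simp add: rep_one del: wreath_prod_simps)
    finally show False using card_gt_0_iff[of base] base_0 by auto
  qed
  then obtain g a where g: "g \<in> base" and nz: "alg_image (\<lambda>x. inertia_char g a (inv\<^bsub>wreath_prod\<^esub> x)) \<noteq> 0\<^sub>m d d" by blast
  have "mat_trace (\<rho> x) = induced_char g a x" if x: "x \<in> carrier wreath_prod" for x
  proof -
    obtain v q where vq: "x = (v, q)" "v \<in> base" using x by auto
    let ?U = "{x \<in> carrier wreath_prod. inertia_char g a x \<noteq> 0}"
    have "?U = base \<times> stab g" by (auto simp: inertia_char_def split: if_splits)
    then have cU: "card ?U = card base * card (stab g)" by (simp add: card_cartesian_product)
    have "mat_trace (\<rho> x) = (\<Sum>y\<in>carrier wreath_prod. inertia_char g a (y \<otimes>\<^bsub>wreath_prod\<^esub> x \<otimes>\<^bsub>wreath_prod\<^esub> inv\<^bsub>wreath_prod\<^esub> y)) / of_nat (card ?U)"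
    proof (rule monomial_character[OF irr _ _ _ nz x])
      show "inertia_char g a \<one>\<^bsub>wreath_prod\<^esub> = 1" by (simp add: inertia_char_def)
    qed (use inertia_char_mult[of _ _ g a] inertia_char_mackey[OF g, of _ a] in blast)+
    also have "(\<Sum>y\<in>carrier wreath_prod. inertia_char g a (y \<otimes>\<^bsub>wreath_prod\<^esub> x \<otimes>\<^bsub>wreath_prod\<^esub> inv\<^bsub>wreath_prod\<^esub> y))
        = (\<Sum>(u, p)\<in>base \<times> UNIV. if q \<in> stab g then bsign (dot a q) * bsign (pairing g (shift p v)) else 0)"
    proof (rule sum.cong)
      fix y assume "y \<in> base \<times> (UNIV :: 'q set)"
      then obtain u p where y: "y = (u, p)" "u \<in> base" by auto
      have "y \<otimes>\<^bsub>wreath_prod\<^esub> x \<otimes>\<^bsub>wreath_prod\<^esub> inv\<^bsub>wreath_prod\<^esub> y = (u + shift p v + shift q u, q)"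
        using y(2) by (simp add: y(1) vq inv_wreath_prod)
      then show "inertia_char g a (y \<otimes>\<^bsub>wreath_prod\<^esub> x \<otimes>\<^bsub>wreath_prod\<^esub> inv\<^bsub>wreath_prod\<^esub> y)
          = (case y of (u, p) \<Rightarrow> if q \<in> stab g then bsign (dot a q) * bsign (pairing g (shift p v)) else 0)"
        by (auto simp: y inertia_char_def pairing_add_right pairing_shift_stab bsign_add bsign_def)
    qed simp
    also have "\<dots> = of_nat (card base) * (if q \<in> stab g then bsign (dot a q) * orbit_sum g v else 0)"
      by (simp add: sum.cartesian_product[symmetric] orbit_sum_def sum_distrib_left)
    finally have "mat_trace (\<rho> x) = of_nat (card base) * (if q \<in> stab g then bsign (dot a q) * orbit_sum g v else 0)
        / of_nat (card base * card (stab g))" unfolding cU .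
    moreover have "card base \<noteq> 0" using base_0 by (metis card_eq_0_iff empty_iff finite_base)
    ultimately show ?thesis by (simp add: induced_char_def vq)
  qed
  then show ?thesis using that g by blast
qed

end

section \<open>A coprime action on the wreath product\<close>

definition cyclic :: "nat \<Rightarrow> nat monoid" where
  "cyclic m = \<lparr>carrier = {..<m}, mult = (\<lambda>i j. (i + j) mod m), one = 0\<rparr>"

lemma group_cyclic: "0 < m \<Longrightarrow> group (cyclic m)"
proof (rule groupI)
  fix x assume m: "0 < m" and x: "x \<in> carrier (cyclic m)"
  show "\<exists>y\<in>carrier (cyclic m). y \<otimes>\<^bsub>cyclic m\<^esub> x = \<one>\<^bsub>cyclic m\<^esub>"
    using m x by (intro bexI[of _ "(m - x) mod m"]) (auto simp: cyclic_def mod_simps)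
qed (auto simp: cyclic_def mod_simps add.assoc)

lemma funpow_mod:
  assumes "\<And>x. (f ^^ m) x = x"
  shows "(f ^^ (k mod m)) x = (f ^^ k) x"
proof -
  have "(f ^^ (m * j)) x = x" for j
    by (induction j) (simp_all add: funpow_add assms)
  then have "(f ^^ (k mod m + m * (k div m))) x = (f ^^ (k mod m)) x"
    unfolding funpow_add by simp
  then show ?thesis by simp
qed

text \<open>An automorphism \<open>T\<close> of \<open>'q\<close> acts on the wreath product by acting on the arguments of the base functions.
  What makes characters vanish is the \<open>T\<close>-invariant function \<open>b\<close>, which takes both values equally often.
  Its existence forces \<open>m\<close> to have at least two prime divisors: if \<open>m\<close> were a power of a prime, necessarily odd, this prime
  would divide the size of every orbit of \<open>T\<close> other than \<open>{0}\<close>, hence also \<open>CARD('q) / 2\<close>, the number of points at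
  which \<open>b\<close> differs from \<open>b 0\<close>; but that number is a power of 2.\<close>

locale wreath_action = wreath n dot
  for n and dot :: "'q::{finite,ab_group_add} \<Rightarrow> 'q \<Rightarrow> bit" +
  fixes T T' :: "'q \<Rightarrow> 'q" and m :: nat and b :: "'q \<Rightarrow> bit"
  assumes T_add: "T (x + y) = T x + T y"
    and T'_T [simp]: "T' (T x) = x" and T_T' [simp]: "T (T' x) = x"
    and T_free: "T x = x \<Longrightarrow> x = 0"
    and T_order: "(T ^^ m) x = x" and m: "1 < m" "odd m" "coprime m CARD('q)"
    and b_T [simp]: "b (T x) = b x"
    and b_balanced: "(\<Sum>x\<in>UNIV. bsign (b x)) = 0"
begin

lemma T_0 [simp]: "T 0 = 0"
  using T_add[of 0 0] by simp

lemma T'_add: "T' (x + y) = T' x + T' y"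
  by (metis T_T' T'_T T_add)

lemma bij_T: "bij T"
  by (rule bij_betw_byWitness[where f' = T']) auto

text \<open>As \<open>T\<close> is free of fixed points, \<open>T - id\<close> is injective, hence bijective.\<close>

lemma T_solve: obtains z where "T z = z + p"
proof -
  have "inj (\<lambda>z. T z - z)"
  proof (rule injI)
    fix x y assume "T x - x = T y - y"
    moreover have "T x = T (x - y) + T y" by (simp flip: T_add)
    ultimately have "T (x - y) = x - y" by (simp add: algebra_simps)
    then show "x = y" using T_free by fastforce
  qed
  then have "surj (\<lambda>z. T z - z)" by (simp add: finite_UNIV_inj_surj)
  then obtain z where "p = T z - z" by blast
  then show ?thesis using that[of z] by simp
qed

definition pull :: "(nat \<Rightarrow> 'q \<Rightarrow> bit) \<Rightarrow> nat \<Rightarrow> 'q \<Rightarrow> bit" where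
  "pull v = (\<lambda>i x. v i (T x))"

text \<open>The inverse \<open>T'\<close> on the second component matches precomposition with \<open>T\<close> on the first one.\<close>

definition act :: "(nat \<Rightarrow> 'q \<Rightarrow> bit) \<times> 'q \<Rightarrow> (nat \<Rightarrow> 'q \<Rightarrow> bit) \<times> 'q" where
  "act = (\<lambda>(v, q). (pull v, T' q))"

definition power_act :: "nat \<Rightarrow> (nat \<Rightarrow> 'q \<Rightarrow> bit) \<times> 'q \<Rightarrow> (nat \<Rightarrow> 'q \<Rightarrow> bit) \<times> 'q" where
  "power_act k = restrict (act ^^ k) (carrier wreath_prod)"

lemma pull_add [simp]: "pull (v + w) = pull v + pull w"
  by (auto simp: pull_def fun_eq_iff)

lemma pull_shift: "pull (shift q v) = shift (T' q) (pull v)"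
  by (simp add: pull_def shift_def T_add)

lemma base_pull [simp]: "v \<in> base \<Longrightarrow> pull v \<in> base"
  by (auto simp: base_def pull_def)

lemma pairing_pull: "pairing (pull g) (pull v) = pairing g v"
  unfolding pairing_def pull_def
  by (intro sum.cong refl sum.reindex_bij_betw[OF bij_T, where g = "\<lambda>x. g i x * v i x" for i])

lemma funpow_act: "(act ^^ k) (v, q) = ((\<lambda>i x. v i ((T ^^ k) x)), (T' ^^ k) q)"
  by (induction k arbitrary: v q) (simp_all add: act_def pull_def funpow_swap1)

lemma act_order: "(act ^^ m) x = x"
proof -
  have "(T' ^^ k) ((T ^^ k) y) = y" for k y
    by (induction k)
       (simp_all only: funpow_0 funpow_Suc_right[of _ T'] funpow.simps(2)[of _ T] comp_apply T'_T)
  from this[of m] have "(T' ^^ m) y = y" for y by (simp add: T_order)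
  then show ?thesis by (cases x) (simp add: funpow_act T_order)
qed

lemma act_carrier: "x \<in> carrier wreath_prod \<Longrightarrow> act x \<in> carrier wreath_prod"
  by (auto simp: act_def)

lemma funpow_act_carrier: "x \<in> carrier wreath_prod \<Longrightarrow> (act ^^ k) x \<in> carrier wreath_prod"
  by (induction k) (simp_all add: act_carrier del: wreath_prod_simps)

lemma funpow_act_mult:
  "x \<in> carrier wreath_prod \<Longrightarrow> y \<in> carrier wreath_prod \<Longrightarrow> (act ^^ k) (x \<otimes>\<^bsub>wreath_prod\<^esub> y) = (act ^^ k) x \<otimes>\<^bsub>wreath_prod\<^esub> (act ^^ k) y"
proof (induction k)
  case (Suc k)
  have "act (x \<otimes>\<^bsub>wreath_prod\<^esub> y) = act x \<otimes>\<^bsub>wreath_prod\<^esub> act y" for x y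
    by (cases x; cases y) (simp add: act_def pull_shift T'_add)
  then show ?case using Suc by simp
qed simp

lemma power_act_auto: "power_act k \<in> auto wreath_prod"
proof -
  have "bij_betw (act ^^ k) (carrier wreath_prod) (carrier wreath_prod)"
  proof (rule bij_betw_byWitness[where f' = "act ^^ ((m - 1) * k)"])
    have "(act ^^ (m * k)) x = x" for x
      using funpow_mod[of m act "m * k" x] act_order by simp
    moreover have "(m - 1) * k + k = m * k" "k + (m - 1) * k = m * k"
      using m(1) by (simp_all add: algebra_simps)
    ultimately have "(act ^^ ((m - 1) * k)) ((act ^^ k) x) = x" "(act ^^ k) ((act ^^ ((m - 1) * k)) x) = x" for x
      using funpow_add[of "(m - 1) * k" k act] funpow_add[of k "(m - 1) * k" act] by (metis comp_apply)+
    then show "\<forall>x\<in>carrier wreath_prod. (act ^^ ((m - 1) * k)) ((act ^^ k) x) = x"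
      "\<forall>x\<in>carrier wreath_prod. (act ^^ k) ((act ^^ ((m - 1) * k)) x) = x" by blast+
  qed (use funpow_act_carrier in blast)+
  then show ?thesis
    unfolding auto_def Bij_def power_act_def
    by (auto simp: hom_def funpow_act_carrier funpow_act_mult wreath_prod.m_closed bij_betw_restrict_eq
             simp del: wreath_prod_simps)
qed

lemma coprime_action_wreath_prod: "coprime_action (cyclic m) wreath_prod power_act"
proof -
  have comp: "power_act ((i + j) mod m) = compose (carrier wreath_prod) (power_act i) (power_act j)" for i j
  proof
    fix x
    show "power_act ((i + j) mod m) x = compose (carrier wreath_prod) (power_act i) (power_act j) x"
      by (cases "x \<in> carrier wreath_prod")
         (simp_all add: power_act_def compose_def funpow_mod[of m act, OF act_order] funpow_add
            funpow_act_carrier del: wreath_prod_simps)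
  qed
  have Bij: "power_act k \<in> Bij (carrier wreath_prod)" for k
    using power_act_auto[of k] by (simp add: auto_def del: wreath_prod_simps)
  have "power_act \<in> hom (cyclic m) (AutoGroup wreath_prod)"
    by (rule homI)
       (simp_all add: cyclic_def AutoGroup_def BijGroup_def power_act_auto Bij comp del: wreath_prod_simps)
  moreover have "coprime m (card (carrier wreath_prod))"
    using m by (simp add: card_cartesian_product card_base)
  ultimately show ?thesis
    using m group_wreath_prod finite_wreath_prod group_cyclic[of m] unfolding coprime_action_def
    by (simp add: cyclic_def del: wreath_prod_simps)
qed

lemma fixed_points_wreath_prod: "fixed_points (cyclic m) wreath_prod power_act = {v \<in> base. pull v = v} \<times> {0}"
proof (intro equalityI subsetI)
  fix x assume "x \<in> fixed_points (cyclic m) wreath_prod power_act"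
  then have x: "x \<in> carrier wreath_prod" "power_act 1 x = x"
    using m by (auto simp: fixed_points_def cyclic_def simp del: wreath_prod_simps)
  then obtain v q where vq: "x = (v, q)" "v \<in> base" by auto
  have "act x = x" using x by (simp add: power_act_def del: wreath_prod_simps)
  then have "pull v = v" "T' q = q" by (auto simp: act_def vq)
  moreover from this(2) have "T q = q" using T_T'[of q] by simp
  ultimately show "x \<in> {v \<in> base. pull v = v} \<times> {0}" using vq T_free[of q] by simp
next
  fix x assume x: "x \<in> {v \<in> base. pull v = v} \<times> {0::'q}"
  have "act x = x" using x T'_T[of 0] by (auto simp: act_def simp del: T'_T)
  then have "(act ^^ k) x = x" for k by (induction k) auto
  then show "x \<in> fixed_points (cyclic m) wreath_prod power_act"
    using x by (auto simp: fixed_points_def power_act_def)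
qed

lemma orbit_sum_shift [simp]: "orbit_sum (shift q g) v = orbit_sum g v"
  unfolding orbit_sum_def
  by (rule sum.reindex_bij_witness[of _ "\<lambda>p. p + q" "\<lambda>p. p - q"]) (auto simp: pairing_shift)

lemma stab_shift [simp]: "stab (shift q g) = stab g"
  unfolding stab_def
  by (metis (no_types, opaque_lifting) add.commute shift_eq_iff shift_simps(2))

lemma induced_char_shift [simp]: "induced_char (shift q g) a = induced_char g a"
  by (simp add: induced_char_def fun_eq_iff)

text \<open>Up to a factor, \<open>orbit_sum g\<close> is the restriction of \<open>induced_char g a\<close> to the base group. Its inner products
  with base characters show which of them occur in it: exactly the translates of \<open>g\<close>.\<close>

lemma sum_bsign_orbit_sum:
  assumes "g \<in> base" "h \<in> base"
  shows "(\<Sum>v\<in>base. bsign (pairing h v) * orbit_sum g v) = of_nat (card base * card {p. shift p g = h})"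
proof -
  have "(\<Sum>v\<in>base. bsign (pairing h v) * orbit_sum g v)
      = (\<Sum>p\<in>UNIV. \<Sum>v\<in>base. bsign (pairing (shift (- p) g + h) v))"
    unfolding orbit_sum_def sum_distrib_left
    by (subst sum.swap) (simp add: pairing_shift pairing_add_left bsign_add mult.commute)
  also have "\<dots> = (\<Sum>p\<in>UNIV. if shift (- p) g = h then of_nat (card base) else 0)"
    using assms by (simp add: sum_bsign_pairing bit_fun_add_eq_0)
  also have "\<dots> = (\<Sum>p\<in>UNIV. if shift p g = h then of_nat (card base) else 0)"
    by (rule sum.reindex_bij_witness[of _ uminus uminus]) auto
  also have "\<dots> = of_nat (card base * card {p. shift p g = h})"
    by (simp add: sum.If_cases)
  finally show ?thesis .
qed

text \<open>By invariance of the restriction to the base group, \<open>pull g\<close> occurs in it and so is a translate of \<open>g\<close>,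
  say by \<open>p\<close>. Translating \<open>g\<close> by \<open>T z\<close> turns the condition of being fixed into \<open>T z = z + p\<close>.\<close>

lemma invariant_character:
  assumes g: "g \<in> base"
    and inv: "\<And>x. x \<in> carrier wreath_prod \<Longrightarrow> induced_char g a (act x) = induced_char g a x"
  obtains h where "h \<in> base" "pull h = h" "induced_char h a = induced_char g a"
proof -
  have orb: "orbit_sum g (pull v) = orbit_sum g v" if v: "v \<in> base" for v
  proof -
    have "card (stab g) \<noteq> 0" using stab_0[of g] by (metis card_eq_0_iff empty_iff finite)
    moreover have "T' 0 = 0" using T'_T[of 0] by (simp del: T'_T)
    ultimately show ?thesis using inv[of "(v, 0)"] v by (simp add: induced_char_def act_def)
  qed
  have pullV: "bij_betw pull base base"
  proof (rule bij_betw_byWitness[where f' = "\<lambda>v i x. v i (T' x)"])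
    show "(\<lambda>v i x. v i (T' x)) ` base \<subseteq> base" by (auto simp: base_def)
  qed (auto simp: pull_def[abs_def] base_def)
  have "(\<Sum>v\<in>base. bsign (pairing (pull g) v) * orbit_sum g v)
      = (\<Sum>v\<in>base. bsign (pairing (pull g) (pull v)) * orbit_sum g (pull v))"
    by (rule sum.reindex_bij_betw[OF pullV, symmetric])
  also have "\<dots> = (\<Sum>v\<in>base. bsign (pairing g v) * orbit_sum g v)"
    by (simp add: pairing_pull orb)
  also have "\<dots> = of_nat (card base * card {p. shift p g = g})"
    by (rule sum_bsign_orbit_sum[OF g g])
  finally have "card base * card {p. shift p g = pull g} = card base * card {p. shift p g = g}"
    unfolding sum_bsign_orbit_sum[OF g base_pull[OF g]] of_nat_eq_iff .
  moreover have "card base \<noteq> 0" using base_0 by (metis card_eq_0_iff empty_iff finite_base)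
  moreover have "card {p. shift p g = g} \<noteq> 0"
    using stab_0[of g] unfolding stab_def by (metis card_eq_0_iff empty_iff finite)
  ultimately have "{p. shift p g = pull g} \<noteq> {}" by force
  then obtain p where p: "shift p g = pull g" by blast
  obtain z where z: "T z = z + p" by (rule T_solve)
  have "pull (shift (T z) g) = shift (T z) g"
    by (simp add: pull_shift p[symmetric]) (simp add: z)
  then show ?thesis using that[of "shift (T z) g"] g by simp
qed

text \<open>Regard functions on \<open>'q\<close> as elements of the group algebra over the field with two elements. There \<open>h i\<close> is
  its own inverse: in characteristic 2, and as \<open>'q\<close> has exponent 2, its square is the square of its augmentation, which is 1.
  So the convolution of \<open>h i\<close> with \<open>b\<close> is a fixed point \<open>c\<close> whose convolution with \<open>h i\<close> is \<open>b\<close> again, and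
  the character sum over its translates is the sum of the signs of \<open>b\<close>, which is zero.\<close>

lemma odd_copy_vanishes:
  assumes h: "h \<in> base" "pull h = h" and i: "i < n" and odd: "(\<Sum>x\<in>UNIV. h i x) = 1"
  obtains c where "c \<in> base" "pull c = c" "orbit_sum h c = 0"
proof -
  define c where "c = (\<lambda>j x. if j = i then \<Sum>y\<in>UNIV. h i y * b (x + y) else 0)"
  have "c \<in> base" using i by (auto simp: c_def base_def)
  moreover have "pull c = c"
  proof -
    have hT: "h i (T x) = h i x" for x using h(2) by (metis pull_def)
    have "(\<Sum>y\<in>UNIV. h i y * b (T x + y)) = (\<Sum>y\<in>UNIV. h i (T y) * b (T x + T y))" for x
      by (rule sum.reindex_bij_betw[OF bij_T, symmetric])
    then show ?thesis by (auto simp: pull_def c_def fun_eq_iff hT T_add[symmetric])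
  qed
  moreover have "pairing h (shift p c) = b p" for p
  proof -
    have exp2: "x + x = 0" for x :: 'q
      using dot_nondegenerate[of "x + x"] by (auto simp: dot_add_right)
    have "pairing h (shift p c) = (\<Sum>j<n. if j = i then \<Sum>x\<in>UNIV. h i x * (\<Sum>y\<in>UNIV. h i y * b (x + p + y)) else 0)"
      unfolding pairing_def by (intro sum.cong) (auto simp: c_def shift_def)
    also have "\<dots> = (\<Sum>x\<in>UNIV. \<Sum>y\<in>UNIV. h i x * h i y * b (x + y + p))"
      using i by (simp add: sum_distrib_left ac_simps)
    also have "\<dots> = (\<Sum>x\<in>UNIV. h i x * h i x * b (x + x + p))"
      by (rule sum_symmetric_bit) (auto simp: ac_simps)
    also have "\<dots> = (\<Sum>x\<in>UNIV. h i x * b p)"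
      by (intro sum.cong refl) (use bit_not_zero_iff in \<open>auto simp: exp2\<close>)
    also have "\<dots> = b p" by (simp add: sum_distrib_right[symmetric] odd)
    finally show ?thesis .
  qed
  then have "orbit_sum h c = 0" by (simp add: orbit_sum_def b_balanced)
  ultimately show ?thesis using that by blast
qed

definition even_fixed :: "(nat \<Rightarrow> 'q \<Rightarrow> bit) set" where
  "even_fixed = {h \<in> base. pull h = h \<and> (\<forall>i<n. (\<Sum>x\<in>UNIV. h i x) = 0)}"

lemma nonvanishing_wreath_prod:
  "nonvanishing_Irr (cyclic m) wreath_prod power_act \<subseteq> (\<lambda>(h, a). restrict (induced_char h a) (carrier wreath_prod)) ` (even_fixed \<times> UNIV)"
proof
  fix \<chi> assume \<chi>: "\<chi> \<in> nonvanishing_Irr (cyclic m) wreath_prod power_act"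
  then obtain d \<rho> where irr: "irreducible_rep wreath_prod d \<rho>" and \<chi>_def: "\<chi> = rep_character wreath_prod d \<rho>"
    by (auto simp: nonvanishing_Irr_def invariant_Irr_def Irr_def)
  obtain g a where g: "g \<in> base" and induced_char: "\<And>x. x \<in> carrier wreath_prod \<Longrightarrow> mat_trace (\<rho> x) = induced_char g a x"
    using irreducible_character[OF irr] by blast
  have \<chi>_ind: "\<chi> x = induced_char g a x" if "x \<in> carrier wreath_prod" for x
  proof -
    have "\<rho> x \<in> carrier_mat d d"
      using irr that unfolding irreducible_rep_def matrix_rep_def by blast
    then have "\<chi> x = mat_trace (\<rho> x)" using that by (simp add: \<chi>_def rep_character_def mat_trace_def del: wreath_prod_simps)
    then show ?thesis using induced_char that by simp
  qed
  have "induced_char g a (act x) = induced_char g a x" if x: "x \<in> carrier wreath_prod" for x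
  proof -
    have "1 \<in> carrier (cyclic m)" using m by (simp add: cyclic_def)
    then have "\<chi> (power_act 1 x) = \<chi> x"
      using \<chi> x unfolding nonvanishing_Irr_def invariant_Irr_def by blast
    then show ?thesis
      using x act_carrier[OF x] by (simp add: \<chi>_ind power_act_def del: wreath_prod_simps)
  qed
  then obtain h where h: "h \<in> base" "pull h = h" "induced_char h a = induced_char g a"
    using invariant_character[OF g] by blast
  have "(\<Sum>x\<in>UNIV. h i x) = 0" if i: "i < n" for i
  proof (rule ccontr)
    assume "(\<Sum>x\<in>UNIV. h i x) \<noteq> 0"
    then obtain c where c: "c \<in> base" "pull c = c" "orbit_sum h c = 0"
      using odd_copy_vanishes[OF h(1,2) i] by auto
    have "\<chi> (c, 0) = induced_char h a (c, 0)" using c by (simp add: \<chi>_ind h(3))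
    also have "\<dots> = 0" using c by (simp add: induced_char_def)
    finally show False
      using \<chi> c unfolding nonvanishing_Irr_def fixed_points_wreath_prod by auto
  qed
  then have "h \<in> even_fixed" using h by (simp add: even_fixed_def)
  moreover have "\<chi> = restrict (induced_char h a) (carrier wreath_prod)"
    using \<chi>_ind h(3) by (auto simp: fun_eq_iff \<chi>_def rep_character_def restrict_def)
  ultimately show "\<chi> \<in> (\<lambda>(h, a). restrict (induced_char h a) (carrier wreath_prod)) ` (even_fixed \<times> UNIV)"
    by (intro image_eqI[of _ _ "(h, a)"]) auto
qed

text \<open>Changing the value at the fixed point 0 of \<open>T\<close> changes the parity of a component and keeps
  invariance, so the \<open>2 ^ n\<close> parity patterns occur equally often among the fixed points.\<close>

lemma card_even_fixed: "card even_fixed * 2 ^ n \<le> card {v \<in> base. pull v = v}"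
proof -
  define f :: "(nat \<Rightarrow> 'q \<Rightarrow> bit) \<times> nat set \<Rightarrow> nat \<Rightarrow> 'q \<Rightarrow> bit"
    where "f = (\<lambda>(g, s) i x. g i x + (if i \<in> s \<and> x = 0 then 1 else 0))"
  have "T x = 0 \<longleftrightarrow> x = 0" for x by (metis T'_T T_0)
  then have "f ` (even_fixed \<times> Pow {..<n}) \<subseteq> {v \<in> base. pull v = v}"
    by (auto simp: f_def even_fixed_def base_def pull_def fun_eq_iff)
  moreover have "inj_on f (even_fixed \<times> Pow {..<n})"
  proof (rule inj_onI, clarify)
    fix g s h t
    assume g: "g \<in> even_fixed" and h: "h \<in> even_fixed" and st: "s \<subseteq> {..<n}" "t \<subseteq> {..<n}"
      and eq: "f (g, s) = f (h, t)"
    have parity: "(\<Sum>x\<in>UNIV. f (g, s) i x) = (if i \<in> s then 1 else 0)"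
      if "g \<in> even_fixed" "i < n" for g s i
      using that by (simp add: f_def even_fixed_def sum.distrib)
    have "i \<in> s \<longleftrightarrow> i \<in> t" if "i < n" for i
      using parity[OF g that, of s] parity[OF h that, of t] eq by (auto split: if_splits)
    then have "s = t" using st by blast
    moreover have "g i x = h i x" for i x
      using fun_cong[OF fun_cong[OF eq, of i], of x] \<open>s = t\<close> by (simp add: f_def)
    ultimately show "g = h \<and> s = t" by blast
  qed
  ultimately have "card (even_fixed \<times> Pow {..<n}) \<le> card {v \<in> base. pull v = v}"
    by (intro card_inj_on_le[of f]) simp_all
  then show ?thesis by (simp add: card_cartesian_product card_Pow)
qed

text \<open>The factor \<open>CARD('q)\<close> is a crude bound on the number of twists \<open>a\<close>. It does not depend on \<open>n\<close>, while the
  gain \<open>2 ^ n\<close> does.\<close>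

lemma card_nonvanishing_wreath_prod:
  "card (nonvanishing_Irr (cyclic m) wreath_prod power_act) * 2 ^ n
     \<le> CARD('q) * card (fixed_points (cyclic m) wreath_prod power_act)"
  and finite_nonvanishing_wreath_prod: "finite (nonvanishing_Irr (cyclic m) wreath_prod power_act)"
proof -
  have fin: "finite (even_fixed \<times> (UNIV :: 'q set))" by (simp add: even_fixed_def)
  show "finite (nonvanishing_Irr (cyclic m) wreath_prod power_act)"
    using nonvanishing_wreath_prod finite_imageI[OF fin] by (rule finite_subset)
  have "card (nonvanishing_Irr (cyclic m) wreath_prod power_act) \<le> card (even_fixed \<times> (UNIV :: 'q set))"
    using nonvanishing_wreath_prod fin by (rule surj_card_le[rotated])
  then have "card (nonvanishing_Irr (cyclic m) wreath_prod power_act) * 2 ^ n \<le> card even_fixed * CARD('q) * 2 ^ n"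
    by (simp add: card_cartesian_product)
  also have "\<dots> = CARD('q) * (card even_fixed * 2 ^ n)" by simp
  also have "\<dots> \<le> CARD('q) * card {v \<in> base. pull v = v}"
    using card_even_fixed by (rule mult_le_mono2)
  finally show "card (nonvanishing_Irr (cyclic m) wreath_prod power_act) * 2 ^ n
     \<le> CARD('q) * card (fixed_points (cyclic m) wreath_prod power_act)"
    by (simp add: fixed_points_wreath_prod card_cartesian_product)
qed

end

section \<open>Abelian fixed-point subgroups and transport of actions\<close>

lemma comm_group_fixed_subgroup:
  assumes act: "coprime_action A G \<phi>"
    and comm: "\<And>x y. x \<in> fixed_points A G \<phi> \<Longrightarrow> y \<in> fixed_points A G \<phi> \<Longrightarrow> x \<otimes>\<^bsub>G\<^esub> y = y \<otimes>\<^bsub>G\<^esub> x"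
  shows "comm_group (fixed_subgroup A G \<phi>)"
proof -
  interpret G: group G using act by (simp add: coprime_action_def)
  have hom: "\<phi> a \<in> hom G G" if "a \<in> carrier A" for a
    using act that unfolding coprime_action_def hom_def[of A] AutoGroup_def auto_def by auto
  have "subgroup (fixed_points A G \<phi>) G"
  proof (rule G.subgroupI)
    have "\<phi> a \<one>\<^bsub>G\<^esub> = \<one>\<^bsub>G\<^esub>" if "a \<in> carrier A" for a
      using hom_one[OF hom[OF that]] G.is_group by blast
    then show "fixed_points A G \<phi> \<noteq> {}" by (auto simp: fixed_points_def)
  next
    fix x assume x: "x \<in> fixed_points A G \<phi>"
    have "\<phi> a (inv\<^bsub>G\<^esub> x) = inv\<^bsub>G\<^esub> x" if a: "a \<in> carrier A" for a
    proof -
      interpret group_hom G G "\<phi> a" using hom[OF a] by unfold_locales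
      show ?thesis using x a by (simp add: fixed_points_def)
    qed
    then show "inv\<^bsub>G\<^esub> x \<in> fixed_points A G \<phi>" using x by (simp add: fixed_points_def)
  next
    fix x y assume "x \<in> fixed_points A G \<phi>" "y \<in> fixed_points A G \<phi>"
    then show "x \<otimes>\<^bsub>G\<^esub> y \<in> fixed_points A G \<phi>"
      using hom by (auto simp: fixed_points_def hom_mult[OF hom])
  qed (auto simp: fixed_points_def)
  then have "group (fixed_subgroup A G \<phi>)"
    unfolding fixed_subgroup_def by (rule G.subgroup_imp_group)
  then show ?thesis
    by (rule group.group_comm_groupI) (simp add: fixed_subgroup_def comm)
qed

lemma (in comm_group) card_abelianization:
  assumes "finite (carrier G)"
  shows "card (carrier (abelianization G)) = card (carrier G)"
proof -
  have "carrier (abelianization G) = rcosets {\<one>}"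
    using derived_eq_singleton[of "carrier G"] by (simp add: abelianization_def FactGroup_def)
  also have "card \<dots> = Coset.order G"
    using lagrange[OF triv_subgroup] assms by simp
  finally show ?thesis by (simp add: Coset.order_def)
qed

lemma irreducible_rep_pullback:
  assumes iso: "f \<in> iso G H" and grp: "group G" "group H" and irr: "irreducible_rep H d \<rho>"
  shows "irreducible_rep G d (\<rho> \<circ> f)"
proof -
  interpret group_hom G H f
    using iso grp by (simp add: group_hom_def group_hom_axioms_def iso_def)
  have f: "f ` carrier G = carrier H" using iso by (simp add: iso_def bij_betw_def)
  have "matrix_rep G d (\<rho> \<circ> f)"
    using irr by (simp add: irreducible_rep_def matrix_rep_def)
  then show ?thesis
    using irr unfolding irreducible_rep_def f[symmetric] by simp
qed

text \<open>An injection \<open>f\<close> moves a group, together with the action on it, to another type. On the character side it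
  suffices to pull characters of the copy back along \<open>f\<close>; this is injective because characters are extensional.\<close>

lemma transport_action:
  fixes f :: "'g \<Rightarrow> 'h"
  assumes act: "coprime_action A G \<phi>" and inj: "inj_on f (carrier G)"
  defines "H \<equiv> image_group f G"
    and "\<psi> \<equiv> (\<lambda>a. \<lambda>y\<in>f ` carrier G. f (\<phi> a (inv_into (carrier G) f y)))"
  shows "coprime_action A H \<psi>"
    and "fixed_points A H \<psi> = f ` fixed_points A G \<phi>"
    and "finite (nonvanishing_Irr A G \<phi>) \<Longrightarrow>
           card (nonvanishing_Irr A H \<psi>) \<le> card (nonvanishing_Irr A G \<phi>)"
    and "f \<in> iso G H"
proof -
  interpret G: group G using act by (simp add: coprime_action_def)
  have carH: "carrier H = f ` carrier G" by (simp add: H_def image_group_def)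
  have multH: "f x \<otimes>\<^bsub>H\<^esub> f y = f (x \<otimes>\<^bsub>G\<^esub> y)" if "x \<in> carrier G" "y \<in> carrier G" for x y
    using that inj by (simp add: H_def image_group_def)
  show iso: "f \<in> iso G H"
    using inj by (auto simp: iso_def hom_def carH multH bij_betw_def)
  have "group (H\<lparr>one := f \<one>\<^bsub>G\<^esub>\<rparr>)" by (rule G.iso_imp_img_group[OF iso])
  then have grpH: "group H" by (simp add: H_def image_group_def)
  have \<phi>: "\<phi> a \<in> hom G G" "\<phi> a \<in> Bij (carrier G)" if "a \<in> carrier A" for a
    using act that unfolding coprime_action_def hom_def[of A] AutoGroup_def auto_def by auto
  have \<phi>_car: "\<phi> a x \<in> carrier G" if "a \<in> carrier A" "x \<in> carrier G" for a x
    using hom_in_carrier[OF \<phi>(1)] that by blast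
  have \<psi>: "\<psi> a (f x) = f (\<phi> a x)" if "x \<in> carrier G" for a x
    using that inj by (simp add: \<psi>_def)
  have bij: "bij_betw (\<psi> a) (carrier H) (carrier H)" if a: "a \<in> carrier A" for a
  proof -
    have "bij_betw (\<phi> a) (carrier G) (carrier G)" using \<phi>(2)[OF a] by (simp add: Bij_def)
    then have "bij_betw (f \<circ> \<phi> a \<circ> inv_into (carrier G) f) (carrier H) (carrier H)"
      unfolding carH using inj
      by (intro bij_betw_trans[OF bij_betw_inv_into] bij_betw_trans[where B = "carrier G"]) (auto simp: bij_betw_def)
    then show ?thesis
      by (rule iffD1[OF bij_betw_cong, rotated]) (simp add: \<psi>_def carH)
  qed
  have auto: "\<psi> a \<in> auto H" if a: "a \<in> carrier A" for a
  proof -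
    have "\<psi> a \<in> hom H H"
      using \<phi>_car[OF a] by (auto simp: hom_def carH \<psi> multH hom_mult[OF \<phi>(1)[OF a]])
    moreover have "\<psi> a \<in> extensional (carrier H)" by (simp add: \<psi>_def carH)
    ultimately show ?thesis using bij[OF a] by (simp add: auto_def Bij_def)
  qed
  have "\<psi> (a \<otimes>\<^bsub>A\<^esub> a') = compose (carrier H) (\<psi> a) (\<psi> a')" if a: "a \<in> carrier A" "a' \<in> carrier A" for a a'
  proof
    fix y
    have "\<phi> (a \<otimes>\<^bsub>A\<^esub> a') = compose (carrier G) (\<phi> a) (\<phi> a')"
      using act a \<phi>(2) unfolding coprime_action_def hom_def[of A]
      by (simp add: AutoGroup_def BijGroup_def)
    then show "\<psi> (a \<otimes>\<^bsub>A\<^esub> a') y = compose (carrier H) (\<psi> a) (\<psi> a') y"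
      by (cases "y \<in> carrier H")
         (auto simp: carH \<psi> compose_def \<phi>_car a, simp add: \<psi>_def)
  qed
  then have "\<psi> \<in> hom A (AutoGroup H)"
    using auto by (auto simp: hom_def AutoGroup_def BijGroup_def auto_def)
  moreover have "card (carrier H) = card (carrier G)" using inj by (simp add: carH card_image)
  ultimately show "coprime_action A H \<psi>"
    using act grpH by (simp add: coprime_action_def carH)
  show fp: "fixed_points A H \<psi> = f ` fixed_points A G \<phi>"
    using inj \<phi>_car by (auto simp: fixed_points_def carH \<psi> inj_on_eq_iff[OF inj])
  assume fin: "finite (nonvanishing_Irr A G \<phi>)"
  let ?r = "\<lambda>\<chi>. restrict (\<chi> \<circ> f) (carrier G)"
  show "card (nonvanishing_Irr A H \<psi>) \<le> card (nonvanishing_Irr A G \<phi>)"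
  proof (rule card_inj_on_le[OF _ _ fin])
    show "inj_on ?r (nonvanishing_Irr A H \<psi>)"
    proof (rule inj_onI)
      fix \<chi> \<chi>' assume \<chi>: "\<chi> \<in> nonvanishing_Irr A H \<psi>" "\<chi>' \<in> nonvanishing_Irr A H \<psi>" and eq: "?r \<chi> = ?r \<chi>'"
      have "\<chi> \<in> extensional (carrier H)" "\<chi>' \<in> extensional (carrier H)"
        using \<chi> by (auto simp: nonvanishing_Irr_def invariant_Irr_def Irr_def rep_character_def)
      moreover have "\<chi> y = \<chi>' y" if "y \<in> carrier H" for y
        using that fun_cong[OF eq] by (auto simp: carH) (metis comp_apply restrict_apply')
      ultimately show "\<chi> = \<chi>'" by (rule extensionalityI)
    qed
    show "?r ` nonvanishing_Irr A H \<psi> \<subseteq> nonvanishing_Irr A G \<phi>"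
    proof clarify
      fix \<chi> assume \<chi>: "\<chi> \<in> nonvanishing_Irr A H \<psi>"
      then obtain d \<rho> where irr: "irreducible_rep H d \<rho>" and \<chi>_def: "\<chi> = rep_character H d \<rho>"
        by (auto simp: nonvanishing_Irr_def invariant_Irr_def Irr_def)
      have "?r \<chi> = rep_character G d (\<rho> \<circ> f)"
        by (auto simp: \<chi>_def rep_character_def carH fun_eq_iff)
      then have "?r \<chi> \<in> Irr G"
        using irreducible_rep_pullback[OF iso G.is_group grpH irr] by (auto simp: Irr_def)
      moreover have "?r \<chi> (\<phi> a x) = ?r \<chi> x" if "a \<in> carrier A" "x \<in> carrier G" for a x
      proof -
        have "\<chi> (\<psi> a (f x)) = \<chi> (f x)"
          using \<chi> that unfolding nonvanishing_Irr_def invariant_Irr_def carH by blast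
        then show ?thesis using that by (simp add: \<psi> \<phi>_car)
      qed
      moreover have "?r \<chi> c \<noteq> 0" if "c \<in> fixed_points A G \<phi>" for c
      proof -
        have "\<chi> (f c) \<noteq> 0" using \<chi> that unfolding nonvanishing_Irr_def fp by blast
        then show ?thesis using that by (simp add: fixed_points_def)
      qed
      ultimately show "?r \<chi> \<in> nonvanishing_Irr A G \<phi>"
        by (simp add: nonvanishing_Irr_def invariant_Irr_def)
    qed
  qed
qed

section \<open>An action of the cyclic group of order 21\<close>

text \<open>The action on the additive group of \<open>F\<^sub>4 \<times> F\<^sub>4 \<times> F\<^sub>8\<close>, which has order 128. The maps \<open>mul4\<close> and \<open>mul8\<close> below are
  multiplication by a generator of the multiplicative group of \<open>F\<^sub>4\<close> and of \<open>F\<^sub>8\<close>, in coordinates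
  in which the generator is a companion matrix of \<open>X\<^sup>2 + X + 1\<close> and \<open>X\<^sup>3 + X + 1\<close>, of order 3 and 7.\<close>

type_synonym quad = "bit \<times> bit"
type_synonym oct = "bit \<times> bit \<times> bit"

fun dot7 :: "quad \<times> quad \<times> oct \<Rightarrow> quad \<times> quad \<times> oct \<Rightarrow> bit" where
  "dot7 ((a, a'), (b, b'), (c, c', c'')) ((x, x'), (y, y'), (z, z', z''))
     = a * x + a' * x' + b * y + b' * y' + c * z + c' * z' + c'' * z''"

fun mul4 :: "quad \<Rightarrow> quad" where "mul4 (a, b) = (b, a + b)"
fun mul8 :: "oct \<Rightarrow> oct" where "mul8 (a, b, c) = (b, c, a + b)"
fun div4 :: "quad \<Rightarrow> quad" where "div4 (a, b) = (a + b, a)"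
fun div8 :: "oct \<Rightarrow> oct" where "div8 (a, b, c) = (a + c, a, b)"

definition T7 :: "quad \<times> quad \<times> oct \<Rightarrow> quad \<times> quad \<times> oct" where
  "T7 = (\<lambda>(x, y, z). (mul4 x, mul4 y, mul8 z))"

definition T7' :: "quad \<times> quad \<times> oct \<Rightarrow> quad \<times> quad \<times> oct" where
  "T7' = (\<lambda>(x, y, z). (div4 x, div4 y, div8 z))"

text \<open>The indicator of the origin together with the \<open>9 * 7 = 63\<close> points \<open>(x, y, z)\<close> for which \<open>z\<close> is nonzero and
  \<open>(x, y)\<close> is a nonzero vector on one of the three lines \<open>x = 0\<close>, \<open>y = 0\<close> and \<open>x = y\<close> of the plane over \<open>F\<^sub>4\<close>.
  These are 64 points, half of the group, and each of the conditions is stable under scaling \<open>(x, y)\<close> and \<open>z\<close>.\<close>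

definition balanced7 :: "quad \<times> quad \<times> oct \<Rightarrow> bit" where
  "balanced7 = (\<lambda>(x, y, z). if z = 0 then (if x = 0 \<and> y = 0 then 1 else 0)
      else if (x = 0) \<noteq> (y = 0) \<or> (x = y \<and> x \<noteq> 0) then 1 else 0)"

lemma card_bit: "CARD(bit) = 2"
  by (simp add: UNIV_bit)

lemma bit_ring_simps: "(a::bit) + (a + c) = c" "a * a = a"
  by (cases a; simp)+

lemma mul4_div4 [simp]: "mul4 (div4 x) = x" "div4 (mul4 x) = x"
  by (cases x; simp add: add.commute add.left_commute bit_ring_simps)+

lemma mul8_div8 [simp]: "mul8 (div8 x) = x" "div8 (mul8 x) = x"
  by (cases x; simp add: add.commute add.left_commute bit_ring_simps)+

lemma mul4_0 [simp]: "mul4 x = 0 \<longleftrightarrow> x = 0" and mul4_inj [simp]: "mul4 x = mul4 y \<longleftrightarrow> x = y"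
  by (metis mul4_div4(2) mul4.simps add_0 zero_prod_def) (metis mul4_div4(2))

lemma mul8_0 [simp]: "mul8 x = 0 \<longleftrightarrow> x = 0"
  by (metis mul8_div8(2) mul8.simps add_0 zero_prod_def)

lemma mul4_order: "mul4 (mul4 (mul4 x)) = x"
  by (cases x) (simp add: add.commute add.left_commute bit_ring_simps)

lemma mul8_order: "mul8 (mul8 (mul8 (mul8 (mul8 (mul8 (mul8 x)))))) = x"
  by (cases x) (simp add: add.commute add.left_commute bit_ring_simps)

interpretation field_action: wreath_action n dot7 T7 T7' 21 balanced7 for n
proof
  show "dot7 (a + b) x = dot7 a x + dot7 b x" for a b x
    by (cases "(a, x)" rule: dot7.cases; cases "(b, x)" rule: dot7.cases) (simp add: algebra_simps)
  show "dot7 a (x + y) = dot7 a x + dot7 a y" for a x y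
    by (cases "(a, x)" rule: dot7.cases; cases "(a, y)" rule: dot7.cases) (simp add: algebra_simps)
  show "\<exists>a. dot7 a x = 1" if "x \<noteq> 0" for x
  proof -
    obtain x1 x2 x3 x4 x5 x6 x7 where x: "x = ((x1, x2), (x3, x4), (x5, x6, x7))" by (metis surj_pair)
    show ?thesis
    proof (rule ccontr)
      assume *: "\<nexists>a. dot7 a x = 1"
      have "x1 \<noteq> 1" "x2 \<noteq> 1" "x3 \<noteq> 1" "x4 \<noteq> 1" "x5 \<noteq> 1" "x6 \<noteq> 1" "x7 \<noteq> 1"
        using * spec[of "\<lambda>a. dot7 a x \<noteq> 1" "((1,0),(0,0),(0,0,0))"]
          spec[of "\<lambda>a. dot7 a x \<noteq> 1" "((0,1),(0,0),(0,0,0))"]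
          spec[of "\<lambda>a. dot7 a x \<noteq> 1" "((0,0),(1,0),(0,0,0))"]
          spec[of "\<lambda>a. dot7 a x \<noteq> 1" "((0,0),(0,1),(0,0,0))"]
          spec[of "\<lambda>a. dot7 a x \<noteq> 1" "((0,0),(0,0),(1,0,0))"]
          spec[of "\<lambda>a. dot7 a x \<noteq> 1" "((0,0),(0,0),(0,1,0))"]
          spec[of "\<lambda>a. dot7 a x \<noteq> 1" "((0,0),(0,0),(0,0,1))"]
        by (auto simp: x)
      then show False using that by (simp add: x zero_prod_def)
    qed
  qed
  show "T7 (x + y) = T7 x + T7 y" for x y
    by (cases "(x, y)" rule: dot7.cases) (simp add: T7_def ac_simps)
  show "T7' (T7 x) = x" "T7 (T7' x) = x" for x
    by (simp_all add: T7_def T7'_def split: prod.splits)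
  show "x = 0" if "T7 x = x" for x
    using that by (cases "(x, x)" rule: dot7.cases)
      (auto simp: T7_def zero_prod_def bit_ring_simps)
  show "(T7 ^^ 21) x = x" for x
    by (cases x) (simp add: numeral_eq_Suc T7_def mul4_order mul8_order)
  show "1 < (21::nat)" "odd (21::nat)" by simp_all
  show "coprime 21 (CARD(quad \<times> quad \<times> oct))"
  proof -
    have "coprime (21 :: nat) (2 ^ 7)" by (simp only: coprime_power_right_iff) simp
    then show ?thesis by (simp add: card_bit)
  qed
  show "balanced7 (T7 x) = balanced7 x" for x
    by (simp add: balanced7_def T7_def case_prod_unfold)
  show "(\<Sum>x\<in>UNIV. bsign (balanced7 x)) = 0"
    by (simp add: UNIV_Times_UNIV[symmetric] sum.cartesian_product[symmetric] UNIV_bit balanced7_def zero_prod_def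
         del: UNIV_Times_UNIV)
qed

text \<open>Since \<open>C\<close> is abelian, it equals its abelianization, and the bound \<open>128 / 2 ^ n\<close> on the ratio tends to zero
  as the rank \<open>n\<close> of the wreathed group grows; the action of the cyclic group of order 21 stays the same.\<close>

theorem corollary4:
  fixes \<epsilon> :: real
  assumes "\<epsilon> > 0"
  shows "\<exists>(A :: nat monoid) (G :: nat monoid) (\<phi> :: nat \<Rightarrow> nat \<Rightarrow> nat).
           coprime_action A G \<phi> \<and>
           comm_group (fixed_subgroup A G \<phi>) \<and>
           real (card (nonvanishing_Irr A G \<phi>))
             / real (card (carrier (abelianization (fixed_subgroup A G \<phi>)))) < \<epsilon>"
proof -
  obtain n where n: "128 / \<epsilon> < 2 ^ n" using real_arch_pow[of 2 "128 / \<epsilon>"] by auto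
  let ?A = "cyclic 21" and ?W = "field_action.wreath_prod n" and ?\<phi> = "field_action.power_act n"
  let ?F = "fixed_points ?A ?W ?\<phi>" and ?N = "nonvanishing_Irr ?A ?W ?\<phi>"
  have act: "coprime_action ?A ?W ?\<phi>" by (rule field_action.coprime_action_wreath_prod)
  obtain f :: "_ \<Rightarrow> nat" where inj: "inj_on f (carrier ?W)"
    using finite_imp_inj_to_nat_seg[OF field_action.finite_wreath_prod] by blast
  define G where "G = image_group f ?W"
  define \<psi> where "\<psi> = (\<lambda>a. \<lambda>y\<in>f ` carrier ?W. f (?\<phi> a (inv_into (carrier ?W) f y)))"
  note transport = transport_action[OF act inj, folded G_def \<psi>_def]
  have F: "?F \<subseteq> carrier ?W" by (auto simp: fixed_points_def)
  have comm: "comm_group (fixed_subgroup ?A G \<psi>)"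
  proof (rule comm_group_fixed_subgroup[OF transport(1)])
    fix x y assume "x \<in> fixed_points ?A G \<psi>" "y \<in> fixed_points ?A G \<psi>"
    then obtain v w where v: "v \<in> ?F" "x = f v" and w: "w \<in> ?F" "y = f w" unfolding transport(2) by blast
    have hom: "f \<in> hom ?W G" using transport(4) by (simp add: iso_def)
    have "x \<otimes>\<^bsub>G\<^esub> y = f (v \<otimes>\<^bsub>?W\<^esub> w)" "y \<otimes>\<^bsub>G\<^esub> x = f (w \<otimes>\<^bsub>?W\<^esub> v)"
      unfolding v(2) w(2)
      using hom_mult[OF hom subsetD[OF F v(1)] subsetD[OF F w(1)]]
        hom_mult[OF hom subsetD[OF F w(1)] subsetD[OF F v(1)]] by simp_all
    moreover have "v \<otimes>\<^bsub>?W\<^esub> w = w \<otimes>\<^bsub>?W\<^esub> v"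
      using v(1) w(1) by (auto simp: field_action.fixed_points_wreath_prod add.commute)
    ultimately show "x \<otimes>\<^bsub>G\<^esub> y = y \<otimes>\<^bsub>G\<^esub> x" by simp
  qed
  have finF: "finite ?F" using F field_action.finite_wreath_prod finite_subset by blast
  have carC: "carrier (fixed_subgroup ?A G \<psi>) = f ` ?F" by (simp add: fixed_subgroup_def transport(2))
  have "card (carrier (abelianization (fixed_subgroup ?A G \<psi>))) = card (f ` ?F)"
    using comm_group.card_abelianization[OF comm] finF by (simp add: carC)
  also have "\<dots> = card ?F" using inj F by (meson card_image inj_on_subset)
  finally have C: "card (carrier (abelianization (fixed_subgroup ?A G \<psi>))) = card ?F" .
  have "(0, 0) \<in> ?F" by (simp add: field_action.fixed_points_wreath_prod field_action.pull_def fun_eq_iff)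
  then have F0: "0 < card ?F" using finF by (auto simp: card_gt_0_iff)
  have "CARD(quad \<times> quad \<times> oct) = 128" by (simp add: card_bit)
  then have "card ?N * 2 ^ n \<le> 128 * card ?F" using field_action.card_nonvanishing_wreath_prod[of n] by simp
  from of_nat_mono[OF this, where 'a = real]
  have "real (card ?N) * 2 ^ n \<le> 128 * real (card ?F)" by simp
  moreover have "128 < \<epsilon> * 2 ^ n" using n assms by (simp add: field_simps)
  then have "128 * real (card ?F) < \<epsilon> * 2 ^ n * real (card ?F)"
    using F0 by (intro mult_strict_right_mono) simp_all
  ultimately have "real (card ?N) * 2 ^ n < (\<epsilon> * real (card ?F)) * 2 ^ n"
    by (simp only: mult.assoc mult.commute[of "2 ^ n"])
  then have "real (card ?N) < \<epsilon> * real (card ?F)" by simp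
  moreover have "card (nonvanishing_Irr ?A G \<psi>) \<le> card ?N"
    by (rule transport(3)[OF field_action.finite_nonvanishing_wreath_prod])
  ultimately have "real (card (nonvanishing_Irr ?A G \<psi>)) < \<epsilon> * real (card ?F)" by linarith
  then have "real (card (nonvanishing_Irr ?A G \<psi>))
      / real (card (carrier (abelianization (fixed_subgroup ?A G \<psi>)))) < \<epsilon>"
    using F0 by (simp add: C field_simps)
  then show ?thesis using transport(1) comm by blast
qed

end
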